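(* Let $S$ be a sub-semifield of $\mathbb T$, let $\mathcal M$ be the toric monoid corresponding to the strongly convex rational polyhedral cone $\sigma\subseteq N_{\mathbb R}$, and let $E$ be a congruence on $S[\mathcal M]$ with a finite tropical basis. Suppose that $\widetilde V(E)$ is the closure of $\widetilde V(E)\cap(\mathbb R_{\ge0}\times N_{\mathbb R})$ in $\mathbb R_{\ge0}\times N_{\mathbb R}(\sigma)$. Then $S[\mathcal M]/\sqrt E$ is cancellative.
   Context: Semirings are commutative, with $0$ and $1$, and additively idempotent; they are partially ordered by $a\le b\iff a+b=b$. $\mathbb{T}=\mathbb{R}\cup\{-\infty\}$ is the tropical semifield (addition is max, multiplication is usual addition, $0_{\mathbb T}=-\infty$); $\log:\mathbb{T}\to\mathbb{R}\cup\{-\infty\}$ is the tautological identification, with $\log 0_{\mathbb T}=-\infty$. Toric data: $M$ is a finitely generated free abelian group, $M_{\mathbb R}=M\otimes\mathbb R$, $N_{\mathbb R}=\mathrm{Hom}(M,\mathbb R)$ with pairing $\langle v,u\rangle=v(u)$. For $\sigma\subseteq N_{\mathbb R}$ a strongly convex rational polyhedral cone, $\sigma^\vee=\{u\in M_{\mathbb R}:\langle v,u\rangle\le 0\ \forall v\in\sigma\}$, and the toric monoid corresponding to $\sigma$ is $\mathcal{M}=\sigma^\vee\cap M$. $N_{\mathbb R}(\sigma)$ is the set of monoid homomorphisms $\mathcal{M}\to(\mathbb R\cup\{-\infty\},+)$, with $\langle x,u\rangle=x(u)$, topologized as a subspace of the product $(\mathbb R\cup\{-\infty\})^{\mathcal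 M}$, where $\mathbb R\cup\{-\infty\}$ is given the topology of $[0,\infty)$ via $x\mapsto e^x$. $N_{\mathbb R}\subseteq N_{\mathbb R}(\sigma)$ is identified with the homomorphisms having only finite values. For $f=\sum_u f_u\chi^u\in S[\mathcal M]$ and $(r,x)\in\mathbb R_{\ge0}\times N_{\mathbb R}(\sigma)$, $\widetilde f(r,x)=\max_{u\in\mathrm{supp}(f)}\left(r\log(f_u)+\langle x,u\rangle\right)$ (equal to $-\infty$ if $f=0$). For $E\subseteq S[\mathcal M]^2$, $\widetilde V(E)=\{w\in\mathbb R_{\ge0}\times N_{\mathbb R}(\sigma):\widetilde f(w)=\widetilde g(w)\ \forall (f,g)\in E\}$. A congruence on a semiring $A$ is an equivalence relation respecting the operations. A semiring is cancellative if every nonzero element $a$ satisfies $ab=ac\Rightarrow b=c$. A proper congruence $P$ is prime if $A/P$ is totally ordered and cancellative. The radical $\sqrt E$ is the intersection of all prime congruences containing $E$. A congruence $E$ on $S[\mathcal M]$ has a finite tropical basis if there are $(f_1,g_1),\dots,(f_r,g_r)\in E$ with $\widetilde V(E)=\widetilde V(\{(f_1,g_1),\dots,(f_r,g_r)\})$. *)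

theory Defs
  imports "HOL-Analysis.Analysis" "HOL-Algebra.Ring" "HOL-Library.Poly_Mapping"
begin

section \<open>The tropical semifield\<close>

text \<open>
  The set of real numbers together with minus infinity is realised inside \<^typ>\<open>ereal\<close> by
  removing plus infinity. The tropical semifield is a copy of it, so that its operations can
  be the type class operations, and the morphism back to \<^typ>\<open>ereal\<close> is the tautological
  identification called log.
\<close>

definition R_minf :: "ereal set" where
  "R_minf = {x. x \<noteq> \<infinity>}"

typedef trop = "R_minf" morphisms log_trop Trop
  unfolding R_minf_def by (rule exI[of _ 0]) simp

setup_lifting type_definition_trop

instantiation trop :: comm_semiring_1
begin

lift_definition zero_trop :: trop is "- \<infinity>" by (simp add: R_minf_def)
lift_definition one_trop :: trop is "0" by (simp add: R_minf_def)
lift_definition plus_trop :: "trop \<Rightarrow> trop \<Rightarrow> trop" is max by (simp add: R_minf_def max_def)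
lift_definition times_trop :: "trop \<Rightarrow> trop \<Rightarrow> trop" is "(+)" by (simp add: R_minf_def)

instance
proof
  fix a b c :: trop
  show "a + b + c = a + (b + c)" by transfer (simp add: max.assoc)
  show "a + b = b + a" by transfer (simp add: max.commute)
  show "0 + a = a" by transfer (simp add: max_def)
  show "a * b * c = a * (b * c)" by transfer (simp add: add.assoc)
  show "a * b = b * a" by transfer (simp add: add.commute)
  show "1 * a = a" by transfer simp
  show "0 * a = 0" by transfer (simp add: R_minf_def)
  show "a * 0 = 0" by transfer (simp add: R_minf_def)
  show "(a + b) * c = a * c + b * c"
    by transfer (auto simp: max_def add_right_mono intro!: antisym dest: add_right_mono)
  show "(0::trop) \<noteq> 1" by transfer simp
qed

end

definition sub_semifield :: "trop set \<Rightarrow> bool" where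
  "sub_semifield S \<longleftrightarrow>
     0 \<in> S \<and> 1 \<in> S \<and> (\<forall>a\<in>S. \<forall>b\<in>S. a + b \<in> S \<and> a * b \<in> S) \<and>
     (\<forall>a\<in>S. a \<noteq> 0 \<longrightarrow> (\<exists>b\<in>S. a * b = 1))"

section \<open>Semirings, congruences and radicals\<close>

text \<open>
  Semirings are given by the record type of rings; additive idempotence and commutativity are
  properties of the structures considered below.
\<close>

definition semiring_le :: "('a, 'b) ring_scheme \<Rightarrow> 'a \<Rightarrow> 'a \<Rightarrow> bool" where
  "semiring_le A a b \<longleftrightarrow> a \<oplus>\<^bsub>A\<^esub> b = b"

definition totally_ordered_semiring :: "('a, 'b) ring_scheme \<Rightarrow> bool" where
  "totally_ordered_semiring A \<longleftrightarrow>
     (\<forall>a\<in>carrier A. \<forall>b\<in>carrier A. semiring_le A a b \<or> semiring_le A b a)"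

definition cancellative_semiring :: "('a, 'b) ring_scheme \<Rightarrow> bool" where
  "cancellative_semiring A \<longleftrightarrow>
     (\<forall>a\<in>carrier A. a \<noteq> \<zero>\<^bsub>A\<^esub> \<longrightarrow>
        (\<forall>b\<in>carrier A. \<forall>c\<in>carrier A. a \<otimes>\<^bsub>A\<^esub> b = a \<otimes>\<^bsub>A\<^esub> c \<longrightarrow> b = c))"

definition semiring_congruence :: "('a, 'b) ring_scheme \<Rightarrow> ('a \<times> 'a) set \<Rightarrow> bool" where
  "semiring_congruence A E \<longleftrightarrow> equiv (carrier A) E \<and>
     (\<forall>(a, b)\<in>E. \<forall>(c, d)\<in>E.
        (a \<oplus>\<^bsub>A\<^esub> c, b \<oplus>\<^bsub>A\<^esub> d) \<in> E \<and> (a \<otimes>\<^bsub>A\<^esub> c, b \<otimes>\<^bsub>A\<^esub> d) \<in> E)"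

definition quotient_semiring ::
    "('a, 'b) ring_scheme \<Rightarrow> ('a \<times> 'a) set \<Rightarrow> 'a set ring" where
  "quotient_semiring A E =
     \<lparr> carrier = carrier A // E,
       mult = (\<lambda>X Y. \<Union>x\<in>X. \<Union>y\<in>Y. E `` {x \<otimes>\<^bsub>A\<^esub> y}),
       one = E `` {\<one>\<^bsub>A\<^esub>},
       zero = E `` {\<zero>\<^bsub>A\<^esub>},
       add = (\<lambda>X Y. \<Union>x\<in>X. \<Union>y\<in>Y. E `` {x \<oplus>\<^bsub>A\<^esub> y}) \<rparr>"

definition prime_congruence :: "('a, 'b) ring_scheme \<Rightarrow> ('a \<times> 'a) set \<Rightarrow> bool" where
  "prime_congruence A P \<longleftrightarrow>
     semiring_congruence A P \<and> P \<noteq> carrier A \<times> carrier A \<and>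
     totally_ordered_semiring (quotient_semiring A P) \<and>
     cancellative_semiring (quotient_semiring A P)"

text \<open>
  The intersection with the full relation only matters if no prime congruence contains \<open>E\<close>;
  the empty intersection is the improper congruence.
\<close>

definition congruence_radical ::
    "('a, 'b) ring_scheme \<Rightarrow> ('a \<times> 'a) set \<Rightarrow> ('a \<times> 'a) set" where
  "congruence_radical A E =
     (carrier A \<times> carrier A) \<inter> \<Inter>{P. prime_congruence A P \<and> E \<subseteq> P}"

section \<open>Toric data\<close>

text \<open>
  The lattice \<open>M\<close> is the whole of a type of class \<^class>\<open>ab_group_add\<close>, regarded as a module
  over the integers.
\<close>

definition zscale :: "int \<Rightarrow> 'm::ab_group_add \<Rightarrow> 'm" where
  "zscale k u = (if 0 \<le> k then ((+) u ^^ nat k) 0 else - ((+) u ^^ nat (- k)) 0)"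

lemma zscale_nat: "zscale (int n) u = ((+) u ^^ n) 0"
  by (simp add: zscale_def)

lemma zscale_Suc: "zscale (k + 1) u = zscale k u + u"
proof (cases "0 \<le> k")
  case True
  then have "nat (k + 1) = Suc (nat k)" by simp
  with True show ?thesis by (simp add: zscale_def add.commute)
next
  case False
  then obtain n where n: "k = - int (Suc n)"
    by (metis int_cases of_nat_0_le_iff)
  then have "nat (- k) = Suc n" "nat (- (k + 1)) = n" by auto
  with False n show ?thesis by (cases n) (auto simp: zscale_def)
qed

lemma zscale_pred: "zscale (k - 1) u = zscale k u - u"
  using zscale_Suc[of "k - 1" u] by simp

lemma module_zscale: "module (zscale :: int \<Rightarrow> 'm::ab_group_add \<Rightarrow> 'm)"
proof -
  have z0: "zscale 0 u = 0" and z1: "zscale 1 u = u" for u :: 'm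
    by (simp_all add: zscale_def)
  have add: "zscale (a + b) u = zscale a u + zscale b u" for a b and u :: 'm
  proof (induction a rule: int_induct[where k = 0])
    case (step1 i)
    then show ?case
      using zscale_Suc[of "i + b" u] zscale_Suc[of i u] by (simp add: algebra_simps)
  next
    case (step2 i)
    then show ?case
      using zscale_pred[of "i + b" u] zscale_pred[of i u]
      by (simp add: add_diff_eq[symmetric] diff_add_eq)
  qed (simp add: z0)
  show ?thesis
  proof
    fix a b :: int and u v :: 'm
    show "zscale a (u + v) = zscale a u + zscale a v"
      by (induction a rule: int_induct[where k = 0]) (simp_all add: z0 zscale_Suc zscale_pred)
    show "zscale (a + b) u = zscale a u + zscale b u" by (rule add)
    show "zscale a (zscale b u) = zscale (a * b) u"
    proof (induction a rule: int_induct[where k = 0])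
      case (step1 i)
      then show ?case by (simp add: zscale_Suc distrib_right add z1)
    next
      case (step2 i)
      have "zscale (i * b) u = zscale ((i - 1) * b) u + zscale b u"
        by (simp flip: add add: algebra_simps)
      with step2 show ?case by (simp add: zscale_pred)
    qed (simp add: z0)
    show "zscale 1 u = u" by (rule z1)
  qed
qed

definition fg_free_abelian :: "'m::ab_group_add itself \<Rightarrow> bool" where
  "fg_free_abelian _ \<longleftrightarrow>
     (\<exists>B::'m set. finite B \<and>
        \<not> module.dependent zscale B \<and> module.span zscale B = UNIV)"

definition N_real :: "('m::ab_group_add \<Rightarrow> real) set" where
  "N_real = {v. Modules.additive v}"

definition N_lattice :: "('m::ab_group_add \<Rightarrow> real) set" where
  "N_lattice = {v \<in> N_real. \<forall>u. v u \<in> \<int>}"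

definition rational_polyhedral_cone :: "('m::ab_group_add \<Rightarrow> real) set \<Rightarrow> bool" where
  "rational_polyhedral_cone \<sigma> \<longleftrightarrow>
     (\<exists>G. finite G \<and> G \<subseteq> N_lattice \<and>
        \<sigma> = {(\<lambda>u. \<Sum>g\<in>G. c g * g u) | c. \<forall>g\<in>G. 0 \<le> c g})"

definition strongly_convex_cone :: "('m::ab_group_add \<Rightarrow> real) set \<Rightarrow> bool" where
  "strongly_convex_cone \<sigma> \<longleftrightarrow> (\<forall>v\<in>\<sigma>. (\<lambda>u. - v u) \<in> \<sigma> \<longrightarrow> v = (\<lambda>u. 0))"

text \<open>The intersection of the dual cone with \<open>M\<close>; the dual cone has the sign convention \<open>\<le> 0\<close>.\<close>

definition toric_monoid :: "('m::ab_group_add \<Rightarrow> real) set \<Rightarrow> 'm set" where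
  "toric_monoid \<sigma> = {u. \<forall>v\<in>\<sigma>. v u \<le> 0}"

text \<open>
  \<open>S[\<M>]\<close> inside the finitely supported functions from \<open>M\<close> to the tropical semifield, whose
  multiplication in \<^theory>\<open>HOL-Library.Poly_Mapping\<close> is convolution.
\<close>

definition monoid_semiring ::
    "trop set \<Rightarrow> 'm::ab_group_add set \<Rightarrow> ('m \<Rightarrow>\<^sub>0 trop) ring" where
  "monoid_semiring S \<M> =
     \<lparr> carrier = {f. Poly_Mapping.keys f \<subseteq> \<M> \<and> (\<forall>u. Poly_Mapping.lookup f u \<in> S)},
       mult = (*), one = 1, zero = 0, add = (+) \<rparr>"

text \<open>
  Monoid homomorphisms are functions on \<open>\<M>\<close> only, represented extensionally as required by
  the product topology on functions.
\<close>

definition N_sigma :: "('m::ab_group_add \<Rightarrow> real) set \<Rightarrow> ('m \<Rightarrow> ereal) set" where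
  "N_sigma \<sigma> = {x \<in> toric_monoid \<sigma> \<rightarrow>\<^sub>E R_minf. x 0 = 0 \<and>
     (\<forall>u\<in>toric_monoid \<sigma>. \<forall>v\<in>toric_monoid \<sigma>. x (u + v) = x u + x v)}"

text \<open>The image of \<open>N\<^sub>R\<close> in \<open>N\<^sub>R(\<sigma>)\<close>.\<close>

definition N_finite :: "('m::ab_group_add \<Rightarrow> real) set \<Rightarrow> ('m \<Rightarrow> ereal) set" where
  "N_finite \<sigma> = {x \<in> N_sigma \<sigma>. \<forall>u\<in>toric_monoid \<sigma>. x u \<noteq> - \<infinity>}"

definition exp_minf :: "ereal \<Rightarrow> real" where
  "exp_minf x = (if x = - \<infinity> then 0 else exp (real_of_ereal x))"

definition R_minf_topology :: "ereal topology" where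
  "R_minf_topology = pullback_topology R_minf exp_minf (top_of_set {0..})"

definition N_sigma_topology ::
    "('m::ab_group_add \<Rightarrow> real) set \<Rightarrow> ('m \<Rightarrow> ereal) topology" where
  "N_sigma_topology \<sigma> =
     subtopology (product_topology (\<lambda>_. R_minf_topology) (toric_monoid \<sigma>)) (N_sigma \<sigma>)"

definition tropical_space_topology ::
    "('m::ab_group_add \<Rightarrow> real) set \<Rightarrow> (real \<times> ('m \<Rightarrow> ereal)) topology" where
  "tropical_space_topology \<sigma> = prod_topology (top_of_set {0..}) (N_sigma_topology \<sigma>)"

section \<open>Tropical evaluation\<close>

text \<open>
  The support is finite, so the supremum is a maximum, and it is \<open>-\<infinity>\<close> for the empty support.
\<close>

definition trop_eval :: "('m \<Rightarrow>\<^sub>0 trop) \<Rightarrow> real \<times> ('m \<Rightarrow> ereal) \<Rightarrow> ereal" where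
  "trop_eval f = (\<lambda>(r, x).
     SUP u\<in>Poly_Mapping.keys f. ereal r * log_trop (Poly_Mapping.lookup f u) + x u)"

definition trop_variety :: "('m::ab_group_add \<Rightarrow> real) set \<Rightarrow>
    (('m \<Rightarrow>\<^sub>0 trop) \<times> ('m \<Rightarrow>\<^sub>0 trop)) set \<Rightarrow> (real \<times> ('m \<Rightarrow> ereal)) set" where
  "trop_variety \<sigma> E = {w \<in> {0..} \<times> N_sigma \<sigma>. \<forall>(f, g)\<in>E. trop_eval f w = trop_eval g w}"

definition finite_tropical_basis :: "('m::ab_group_add \<Rightarrow> real) set \<Rightarrow>
    (('m \<Rightarrow>\<^sub>0 trop) \<times> ('m \<Rightarrow>\<^sub>0 trop)) set \<Rightarrow> bool" where
  "finite_tropical_basis \<sigma> E \<longleftrightarrow>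
     (\<exists>F. finite F \<and> F \<subseteq> E \<and> trop_variety \<sigma> E = trop_variety \<sigma> F)"

end

theory Submission
  imports Defs
begin

text \<open>
  To cancel a nonzero \<open>a\<close> from \<open>(a b, a c) \<in> \<surd>E\<close> one has to show \<open>(b, c) \<in> P\<close> for every prime
  congruence \<open>P \<supseteq> E\<close>. A single \<open>P\<close> does not help, because \<open>a\<close> may be zero modulo \<open>P\<close>. The
  primes at which this cannot happen are the kernels of evaluation at points \<open>w = (r, x)\<close> of the
  variety all of whose coordinates are finite: evaluation there is a homomorphism to the
  tropical semifield, so that its kernel is prime (\<open>prime_congruence_at_point\<close>), and it sends
  every nonzero polynomial to a finite value (\<open>trop_eval_finite_point\<close>). Hence \<open>b\<close> and \<open>c\<close> take
  equal values at the finite points of the variety, and by continuity on their closure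
  (\<open>trop_eval_eq_on_closure\<close>), which is the whole variety.

  It remains to pass from the values on the variety back to \<open>P\<close>. This is a tropical
  Nullstellensatz, \<open>realise_polynomials\<close>: for every finite set \<open>H\<close> of polynomials there is a point
  \<open>w\<close>, not necessarily finite, such that two members of \<open>H\<close> are congruent modulo \<open>P\<close> exactly if
  they have equal values at \<open>w\<close>. For \<open>H\<close> consisting of the polynomials in a finite tropical basis
  together with \<open>b\<close> and \<open>c\<close>, such a point lies on the variety, so \<open>b\<close> and \<open>c\<close> agree there and are
  congruent modulo \<open>P\<close>.

  The Nullstellensatz is a question of linear inequalities. The quotient by \<open>P\<close> is totally
  ordered, so \<open>P\<close> is determined by the order on monomials, and a point is wanted that induces the
  same order on the finitely many monomials that occur. If there were none, Motzkin's
  transposition theorem (\<open>solvable_or_refutable\<close>) would yield a contradictory combination of the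
  inequalities. The real scalars and the integral exponents play different roles here: only the
  coordinates of \<open>x\<close> are eliminated, and their coefficients are integers, so the combination has
  integer multipliers. It can therefore be read multiplicatively, as a comparison of monomials
  that holds modulo \<open>P\<close> but compares two scalars in the wrong way.
\<close>

section \<open>Elimination for finite systems of affine inequalities\<close>

text \<open>
  The linear coefficients are integers because they will be coordinates of differences of
  exponents, whereas the constant term is a difference of logarithms of arbitrary scalars. The
  flag marks strict inequalities.
\<close>

type_synonym 'b affine_ineq = "real \<times> ('b \<Rightarrow> int) \<times> bool"

definition holds_at :: "'b set \<Rightarrow> ('b \<Rightarrow> real) \<Rightarrow> 'b affine_ineq \<Rightarrow> bool" where
  "holds_at B x = (\<lambda>(\<gamma>, a, s). if s then 0 < \<gamma> + (\<Sum>b\<in>B. of_int (a b) * x b)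
                                 else 0 \<le> \<gamma> + (\<Sum>b\<in>B. of_int (a b) * x b))"

text \<open>
  Only sums are allowed here, hence nonnegative integer multipliers: a sum of two valid
  comparisons of monomials is again one (multiply them), whereas a real multiple of a
  comparison of monomials has no meaning.
\<close>

inductive_set consequences :: "'b affine_ineq set \<Rightarrow> 'b affine_ineq set"
  for K :: "'b affine_ineq set" where
  base: "k \<in> K \<Longrightarrow> k \<in> consequences K"
| add: "\<lbrakk>(\<gamma>, a, s) \<in> consequences K; (\<delta>, c, t) \<in> consequences K\<rbrakk>
        \<Longrightarrow> (\<gamma> + \<delta>, \<lambda>b. a b + c b, s \<or> t) \<in> consequences K"

lemma consequences_scale:
  assumes "(\<gamma>, a, s) \<in> consequences K"
  shows "(real (Suc n) * \<gamma>, \<lambda>b. int (Suc n) * a b, s) \<in> consequences K"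
proof (induction n)
  case 0
  then show ?case using assms by simp
next
  case (Suc n)
  from consequences.add[OF Suc.IH assms] show ?case
    by (simp add: algebra_simps)
qed

lemma consequences_scale_int:
  assumes "(\<gamma>, a, s) \<in> consequences K" and "0 < m"
  shows "(of_int m * \<gamma>, \<lambda>b. m * a b, s) \<in> consequences K"
proof -
  from \<open>0 < m\<close> obtain n where "m = int (Suc n)"
    using pos_int_cases by (metis gr0_implies_Suc)
  then show ?thesis using consequences_scale[OF assms(1), of n] by simp
qed

lemma consequences_idem:
  assumes "K' \<subseteq> consequences K" and "k \<in> consequences K'"
  shows "k \<in> consequences K"
  using assms(2) by induction (use assms(1) in \<open>auto intro: consequences.intros\<close>)

lemma consequences_vanish:
  assumes "\<And>\<gamma> a s. (\<gamma>, a, s) \<in> K \<Longrightarrow> a b = 0" and "(\<gamma>, a, s) \<in> consequences K"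
  shows "a b = 0"
  using assms(2) by (induction "(\<gamma>, a, s)" arbitrary: \<gamma> a s) (auto dest: assms(1))

text \<open>
  The midpoint of the greatest lower and the least upper bound works: if the two coincide, the
  bounds that attain them are not strict.
\<close>

lemma exists_between_bounds:
  fixes L :: "'p \<Rightarrow> real" and U :: "'q \<Rightarrow> real"
  assumes "finite I" "finite J"
    and LU: "\<And>i j. \<lbrakk>i \<in> I; j \<in> J\<rbrakk> \<Longrightarrow> if s i \<or> t j then L i < U j else L i \<le> U j"
  shows "\<exists>y. (\<forall>i\<in>I. if s i then L i < y else L i \<le> y) \<and> (\<forall>j\<in>J. if t j then y < U j else y \<le> U j)"
proof -
  define l where "l = Max (L ` I)"
  define u where "u = Min (U ` J)"
  have l: "L i \<le> l" if "i \<in> I" for i using that \<open>finite I\<close> by (simp add: l_def)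
  have u: "u \<le> U j" if "j \<in> J" for j using that \<open>finite J\<close> by (simp add: u_def)
  consider "I = {}" | "J = {}" | "I \<noteq> {}" "J \<noteq> {}" by blast
  then show ?thesis
  proof cases
    case 1
    then show ?thesis using u by (intro exI[of _ "u - 1"]) force
  next
    case 2
    then show ?thesis using l by (intro exI[of _ "l + 1"]) force
  next
    case 3
    from 3 have "l \<in> L ` I" "u \<in> U ` J"
      using \<open>finite I\<close> \<open>finite J\<close> by (simp_all add: l_def u_def)
    then obtain i0 j0 where i0: "i0 \<in> I" "l = L i0" and j0: "j0 \<in> J" "u = U j0" by blast
    have "l \<le> u" using LU[OF i0(1) j0(1)] i0 j0 by (auto split: if_splits)
    have "if s i then L i < (l + u) / 2 else L i \<le> (l + u) / 2" if "i \<in> I" for i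
      using LU[OF that j0(1)] l[OF that] j0 \<open>l \<le> u\<close> by (auto split: if_splits)
    moreover have "if t j then (l + u) / 2 < U j else (l + u) / 2 \<le> U j" if "j \<in> J" for j
      using LU[OF i0(1) that] u[OF that] i0 \<open>l \<le> u\<close> by (auto split: if_splits)
    ultimately show ?thesis by blast
  qed
qed

text \<open>
  Motzkin's transposition theorem, by Fourier-Motzkin elimination: eliminating \<open>b\<close> replaces a
  lower bound \<open>p\<close> and an upper bound \<open>q\<close> for \<open>x b\<close> by the combination in which \<open>x b\<close>
  cancels, and since the coefficients are integers, so are the multipliers.
\<close>

theorem solvable_or_refutable:
  assumes "finite B" and "finite K"
  shows "(\<exists>x. \<forall>k\<in>K. holds_at B x k) \<or>
         (\<exists>\<gamma> a s. (\<gamma>, a, s) \<in> consequences K \<and> (\<forall>b\<in>B. a b = 0) \<and> (\<gamma> < 0 \<or> s \<and> \<gamma> \<le> 0))"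
  using assms
proof (induction B arbitrary: K rule: finite_induct)
  case empty
  show ?case
  proof (cases "\<forall>k\<in>K. holds_at {} (\<lambda>_. 0) k")
    case False
    then obtain \<gamma> a s where "(\<gamma>, a, s) \<in> K" "\<not> holds_at {} (\<lambda>_. 0) (\<gamma>, a, s)" by auto
    then have "(\<gamma>, a, s) \<in> consequences K" "\<gamma> < 0 \<or> s \<and> \<gamma> \<le> 0"
      by (auto simp: holds_at_def split: if_splits intro: consequences.base)
    then show ?thesis by blast
  qed blast
next
  case (insert b B)
  define Z where "Z = {k \<in> K. fst (snd k) b = 0}"
  define Lo where "Lo = {k \<in> K. fst (snd k) b > 0}"
  define Up where "Up = {k \<in> K. fst (snd k) b < 0}"
  define cross :: "'a affine_ineq \<Rightarrow> 'a affine_ineq \<Rightarrow> 'a affine_ineq" where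
    "cross = (\<lambda>(\<gamma>, a, s) (\<delta>, c, t).
       (of_int (- c b) * \<gamma> + of_int (a b) * \<delta>, \<lambda>d. - c b * a d + a b * c d, s \<or> t))"
  define K' where "K' = Z \<union> (\<lambda>(p, q). cross p q) ` (Lo \<times> Up)"
  have fin: "finite Lo" "finite Up" "finite K'"
    using \<open>finite K\<close> by (auto simp: K'_def Z_def Lo_def Up_def)
  have sub: "K' \<subseteq> consequences K"
  proof
    fix k assume "k \<in> K'"
    then consider "k \<in> Z"
      | \<gamma> a s \<delta> c t where "(\<gamma>, a, s) \<in> Lo" "(\<delta>, c, t) \<in> Up" "k = cross (\<gamma>, a, s) (\<delta>, c, t)"
      unfolding K'_def by auto
    then show "k \<in> consequences K"
    proof cases
      case 1
      then show ?thesis by (auto simp: Z_def intro: consequences.base)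
    next
      case 2
      then have "(\<gamma>, a, s) \<in> consequences K" "(\<delta>, c, t) \<in> consequences K" "0 < - c b" "0 < a b"
        by (auto simp: Lo_def Up_def intro: consequences.base)
      from consequences.add[OF consequences_scale_int[OF this(1,3)] consequences_scale_int[OF this(2,4)]]
      show ?thesis using 2 by (simp add: cross_def)
    qed
  qed
  have vanish: "a b = 0" if "(\<gamma>, a, s) \<in> K'" for \<gamma> a s
    using that by (auto simp: K'_def Z_def cross_def)
  from insert.IH[OF \<open>finite K'\<close>] show ?case
  proof
    assume "\<exists>\<gamma> a s. (\<gamma>, a, s) \<in> consequences K' \<and> (\<forall>b\<in>B. a b = 0) \<and> (\<gamma> < 0 \<or> s \<and> \<gamma> \<le> 0)"
    then obtain \<gamma> a s where *: "(\<gamma>, a, s) \<in> consequences K'" "\<forall>b\<in>B. a b = 0" "\<gamma> < 0 \<or> s \<and> \<gamma> \<le> 0"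
      by blast
    have "a b = 0" by (rule consequences_vanish[OF _ *(1)]) (rule vanish)
    with consequences_idem[OF sub *(1)] *(2,3) show ?thesis by blast
  next
    assume "\<exists>x. \<forall>k\<in>K'. holds_at B x k"
    then obtain x where x: "\<And>k. k \<in> K' \<Longrightarrow> holds_at B x k" by blast
    \<comment> \<open>The part of the left-hand side that does not involve the unknown \<open>x b\<close>, and the value of
      \<open>x b\<close> at which the whole left-hand side vanishes.\<close>
    define rest where "rest = (\<lambda>k :: 'a affine_ineq. fst k + (\<Sum>d\<in>B. of_int (fst (snd k) d) * x d))"
    define bound where "bound = (\<lambda>k. - rest k / of_int (fst (snd k) b))"
    have rest_cross: "rest (cross p q)
        = of_int (- fst (snd q) b) * rest p + of_int (fst (snd p) b) * rest q" for p q
    proof (cases p, cases q)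
      fix \<gamma> a s \<delta> c t assume [simp]: "p = (\<gamma>, a, s)" "q = (\<delta>, c, t)"
      have "(\<Sum>d\<in>B. of_int (- c b * a d + a b * c d) * x d)
          = of_int (- c b) * (\<Sum>d\<in>B. of_int (a d) * x d) + of_int (a b) * (\<Sum>d\<in>B. of_int (c d) * x d)"
        unfolding sum_distrib_left sum.distrib[symmetric]
        by (intro sum.cong refl) (simp add: algebra_simps)
      then show ?thesis by (simp add: cross_def rest_def distrib_left)
    qed
    have rest_eq: "rest k = - (of_int (fst (snd k) b) * bound k)" if "fst (snd k) b \<noteq> 0" for k
      using that by (simp add: bound_def)
    have LU: "if snd (snd p) \<or> snd (snd q) then bound p < bound q else bound p \<le> bound q"
      if "p \<in> Lo" "q \<in> Up" for p q
    proof -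
      from that have pos: "0 < fst (snd p) b" "fst (snd q) b < 0"
        by (auto simp: Lo_def Up_def)
      then have pos': "0 < real_of_int (fst (snd p) b * - fst (snd q) b)"
        by (simp add: mult_pos_neg)
      have "rest (cross p q) = of_int (fst (snd p) b * - fst (snd q) b) * (bound q - bound p)"
        using pos by (simp add: rest_cross rest_eq algebra_simps)
      then have "0 < rest (cross p q) \<longleftrightarrow> bound p < bound q" "0 \<le> rest (cross p q) \<longleftrightarrow> bound p \<le> bound q"
        using pos' by (simp_all only: zero_less_mult_iff zero_le_mult_iff) auto
      moreover have "cross p q \<in> K'" using that by (auto simp: K'_def)
      from x[OF this] have "if snd (snd p) \<or> snd (snd q) then 0 < rest (cross p q) else 0 \<le> rest (cross p q)"
        by (auto simp: holds_at_def rest_def cross_def split: prod.splits if_splits)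
      ultimately show ?thesis by (auto split: if_splits)
    qed
    from exists_between_bounds[OF fin(1,2), of "\<lambda>p. snd (snd p)" "\<lambda>q. snd (snd q)" bound bound] LU obtain y where
      y: "\<forall>p\<in>Lo. if snd (snd p) then bound p < y else bound p \<le> y"
         "\<forall>q\<in>Up. if snd (snd q) then y < bound q else y \<le> bound q"
      by blast
    have "holds_at (insert b B) (x(b := y)) k" if "k \<in> K" for k
    proof -
      have "(\<Sum>d\<in>B. of_int (fst (snd k) d) * (x(b := y)) d) = (\<Sum>d\<in>B. of_int (fst (snd k) d) * x d)"
        using insert.hyps by (intro sum.cong) auto
      then have iff: "holds_at (insert b B) (x(b := y)) k \<longleftrightarrow>
          (if snd (snd k) then 0 < rest k + of_int (fst (snd k) b) * y
           else 0 \<le> rest k + of_int (fst (snd k) b) * y)"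
        using insert.hyps by (cases k) (simp add: holds_at_def rest_def algebra_simps)
      have "k \<in> Z \<or> k \<in> Lo \<or> k \<in> Up" using that by (simp add: Z_def Lo_def Up_def) linarith
      then consider "k \<in> Z" | "k \<in> Lo" | "k \<in> Up" by blast
      then show ?thesis
      proof cases
        case 1
        then have "holds_at B x k" "fst (snd k) b = 0" by (auto simp: K'_def Z_def intro!: x)
        then show ?thesis unfolding iff by (cases k) (auto simp: holds_at_def rest_def)
      next
        case 2
        then have "0 < fst (snd k) b" by (simp add: Lo_def)
        then have "rest k + of_int (fst (snd k) b) * y = of_int (fst (snd k) b) * (y - bound k)"
          "0 < real_of_int (fst (snd k) b)"
          by (simp_all add: rest_eq right_diff_distrib)
        with y(1) 2 show ?thesis unfolding iff
          by (auto simp: zero_less_mult_iff zero_le_mult_iff split: if_splits)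
      next
        case 3
        then have "fst (snd k) b < 0" by (simp add: Up_def)
        then have "rest k + of_int (fst (snd k) b) * y = of_int (fst (snd k) b) * (y - bound k)"
          "real_of_int (fst (snd k) b) < 0"
          by (simp_all add: rest_eq right_diff_distrib)
        with y(2) 3 show ?thesis unfolding iff
          by (auto simp: zero_less_mult_iff zero_le_mult_iff split: if_splits)
      qed
    qed
    then show ?thesis by blast
  qed
qed

section \<open>Congruences and quotients\<close>

context
  fixes A :: "('a, 'b) ring_scheme" and E :: "('a \<times> 'a) set"
  assumes congr: "semiring_congruence A E"
begin

lemma congruence_equiv: "equiv (carrier A) E"
  using congr by (simp add: semiring_congruence_def)

lemma congruence_add: "(a, b) \<in> E \<Longrightarrow> (c, d) \<in> E \<Longrightarrow> (a \<oplus>\<^bsub>A\<^esub> c, b \<oplus>\<^bsub>A\<^esub> d) \<in> E"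
  and congruence_mult: "(a, b) \<in> E \<Longrightarrow> (c, d) \<in> E \<Longrightarrow> (a \<otimes>\<^bsub>A\<^esub> c, b \<otimes>\<^bsub>A\<^esub> d) \<in> E"
  using congr by (auto simp: semiring_congruence_def)

lemma congruence_refl: "a \<in> carrier A \<Longrightarrow> (a, a) \<in> E"
  and congruence_mem: "(a, b) \<in> E \<Longrightarrow> a \<in> carrier A \<and> b \<in> carrier A"
  using congruence_equiv by (auto simp: equiv_def refl_on_def)

lemma congruence_closed:
  assumes "a \<in> carrier A" "b \<in> carrier A"
  shows "a \<oplus>\<^bsub>A\<^esub> b \<in> carrier A" and "a \<otimes>\<^bsub>A\<^esub> b \<in> carrier A"
  using assms congruence_add[of a a b b] congruence_mult[of a a b b] congruence_refl congruence_mem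
  by blast+

lemma congruence_class_eq_iff:
  "a \<in> carrier A \<Longrightarrow> b \<in> carrier A \<Longrightarrow> E `` {a} = E `` {b} \<longleftrightarrow> (a, b) \<in> E"
  using eq_equiv_class_iff[OF congruence_equiv] by blast

lemma quotient_ops:
  assumes "a \<in> carrier A" "b \<in> carrier A"
  shows "E `` {a} \<oplus>\<^bsub>quotient_semiring A E\<^esub> E `` {b} = E `` {a \<oplus>\<^bsub>A\<^esub> b}"
    and "E `` {a} \<otimes>\<^bsub>quotient_semiring A E\<^esub> E `` {b} = E `` {a \<otimes>\<^bsub>A\<^esub> b}"
proof -
  have "E `` {x \<oplus>\<^bsub>A\<^esub> y} = E `` {a \<oplus>\<^bsub>A\<^esub> b}" "E `` {x \<otimes>\<^bsub>A\<^esub> y} = E `` {a \<otimes>\<^bsub>A\<^esub> b}"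
    if "(a, x) \<in> E" "(b, y) \<in> E" for x y
    using that equiv_class_eq[OF congruence_equiv congruence_add[OF that]]
      equiv_class_eq[OF congruence_equiv congruence_mult[OF that]] by simp_all
  then have "(\<Union>x\<in>E `` {a}. \<Union>y\<in>E `` {b}. E `` {x \<oplus>\<^bsub>A\<^esub> y})
        = (\<Union>x\<in>E `` {a}. \<Union>y\<in>E `` {b}. E `` {a \<oplus>\<^bsub>A\<^esub> b})"
      "(\<Union>x\<in>E `` {a}. \<Union>y\<in>E `` {b}. E `` {x \<otimes>\<^bsub>A\<^esub> y})
        = (\<Union>x\<in>E `` {a}. \<Union>y\<in>E `` {b}. E `` {a \<otimes>\<^bsub>A\<^esub> b})"
    by (intro SUP_cong refl; simp)+
  moreover have "E `` {a} \<noteq> {}" "E `` {b} \<noteq> {}" using assms congruence_refl by blast+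
  ultimately show "E `` {a} \<oplus>\<^bsub>quotient_semiring A E\<^esub> E `` {b} = E `` {a \<oplus>\<^bsub>A\<^esub> b}"
    "E `` {a} \<otimes>\<^bsub>quotient_semiring A E\<^esub> E `` {b} = E `` {a \<otimes>\<^bsub>A\<^esub> b}"
    unfolding quotient_semiring_def by simp_all
qed

lemma ball_quotient: "(\<forall>X\<in>carrier (quotient_semiring A E). Q X) \<longleftrightarrow> (\<forall>a\<in>carrier A. Q (E `` {a}))"
  by (auto simp: quotient_semiring_def quotient_def)

lemma totally_ordered_quotient_iff:
  "totally_ordered_semiring (quotient_semiring A E) \<longleftrightarrow>
     (\<forall>a\<in>carrier A. \<forall>b\<in>carrier A. (a \<oplus>\<^bsub>A\<^esub> b, b) \<in> E \<or> (b \<oplus>\<^bsub>A\<^esub> a, a) \<in> E)"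
  unfolding totally_ordered_semiring_def semiring_le_def ball_quotient
  by (intro ball_cong refl) (simp add: quotient_ops congruence_class_eq_iff congruence_closed)

lemma cancellative_quotient_iff:
  assumes "\<zero>\<^bsub>A\<^esub> \<in> carrier A"
  shows "cancellative_semiring (quotient_semiring A E) \<longleftrightarrow>
     (\<forall>a\<in>carrier A. (a, \<zero>\<^bsub>A\<^esub>) \<notin> E \<longrightarrow>
        (\<forall>b\<in>carrier A. \<forall>c\<in>carrier A. (a \<otimes>\<^bsub>A\<^esub> b, a \<otimes>\<^bsub>A\<^esub> c) \<in> E \<longrightarrow> (b, c) \<in> E))"
proof -
  have "\<zero>\<^bsub>quotient_semiring A E\<^esub> = E `` {\<zero>\<^bsub>A\<^esub>}" by (simp add: quotient_semiring_def)
  then show ?thesis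
    unfolding cancellative_semiring_def ball_quotient
    by (simp add: assms quotient_ops congruence_class_eq_iff congruence_closed cong: ball_cong)
qed

end

text \<open>
  The closure hypotheses serve the full relation that takes part in the intersection.
\<close>

lemma semiring_congruence_radical:
  assumes "\<And>a b. a \<in> carrier A \<Longrightarrow> b \<in> carrier A \<Longrightarrow> a \<oplus>\<^bsub>A\<^esub> b \<in> carrier A"
    and "\<And>a b. a \<in> carrier A \<Longrightarrow> b \<in> carrier A \<Longrightarrow> a \<otimes>\<^bsub>A\<^esub> b \<in> carrier A"
  shows "semiring_congruence A (congruence_radical A E)"
proof -
  let ?R = "congruence_radical A E"
  have R: "(a, b) \<in> ?R \<longleftrightarrow> a \<in> carrier A \<and> b \<in> carrier A \<and>
      (\<forall>P. prime_congruence A P \<and> E \<subseteq> P \<longrightarrow> (a, b) \<in> P)" for a b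
    by (auto simp: congruence_radical_def)
  have "semiring_congruence A P" if "prime_congruence A P" for P
    using that by (simp add: prime_congruence_def)
  note P = congruence_equiv[OF this] congruence_add[OF this] congruence_mult[OF this]
  have "equiv (carrier A) ?R"
  proof (rule equivI)
    show "?R \<subseteq> carrier A \<times> carrier A" by (auto simp: R)
    show "refl_on (carrier A) ?R" using P(1) by (auto simp: refl_on_def equiv_def R)
    show "sym ?R" using P(1) by (auto simp: sym_def equiv_def R)
    show "trans ?R"
    proof (rule transI)
      fix a b c
      assume "(a, b) \<in> ?R" "(b, c) \<in> ?R"
      moreover have "(a, c) \<in> P" if "prime_congruence A P" "(a, b) \<in> P" "(b, c) \<in> P" for P
        using P(1)[OF that(1)] that(2,3) unfolding equiv_def by (meson transD)
      ultimately show "(a, c) \<in> ?R" unfolding R by blast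
    qed
  qed
  moreover have "(a \<oplus>\<^bsub>A\<^esub> c, b \<oplus>\<^bsub>A\<^esub> d) \<in> ?R" "(a \<otimes>\<^bsub>A\<^esub> c, b \<otimes>\<^bsub>A\<^esub> d) \<in> ?R"
    if "(a, b) \<in> ?R" "(c, d) \<in> ?R" for a b c d
  proof -
    have mem: "a \<in> carrier A" "b \<in> carrier A" "c \<in> carrier A" "d \<in> carrier A"
      using that by (simp_all add: R)
    have "(a, b) \<in> P \<and> (c, d) \<in> P" if "prime_congruence A P" "E \<subseteq> P" for P
      using \<open>(a, b) \<in> ?R\<close> \<open>(c, d) \<in> ?R\<close> that by (simp add: R)
    then have "(a \<oplus>\<^bsub>A\<^esub> c, b \<oplus>\<^bsub>A\<^esub> d) \<in> P \<and> (a \<otimes>\<^bsub>A\<^esub> c, b \<otimes>\<^bsub>A\<^esub> d) \<in> P"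
      if "prime_congruence A P" "E \<subseteq> P" for P
      using that P(2,3)[OF that(1)] by blast
    then show "(a \<oplus>\<^bsub>A\<^esub> c, b \<oplus>\<^bsub>A\<^esub> d) \<in> ?R" "(a \<otimes>\<^bsub>A\<^esub> c, b \<otimes>\<^bsub>A\<^esub> d) \<in> ?R"
      unfolding R by (simp_all add: mem assms)
  qed
  ultimately show ?thesis unfolding semiring_congruence_def by auto
qed

section \<open>The total preorder given by a prime congruence\<close>

text \<open>
  A prime congruence on a semiring \<open>C\<close> whose operations are those of the ambient type. The order
  of the quotient is pulled back to a total preorder on \<open>C\<close>.
\<close>

locale prime_order =
  fixes C :: "'a::comm_semiring_1 set" and P :: "('a \<times> 'a) set"
  assumes equiv: "equiv C P"
    and add: "(a, b) \<in> P \<Longrightarrow> (c, d) \<in> P \<Longrightarrow> (a + c, b + d) \<in> P"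
    and mult: "(a, b) \<in> P \<Longrightarrow> (c, d) \<in> P \<Longrightarrow> (a * c, b * d) \<in> P"
    and zero_mem: "0 \<in> C" and one_mem: "1 \<in> C"
    and idem: "a \<in> C \<Longrightarrow> a + a = a"
    and total: "a \<in> C \<Longrightarrow> b \<in> C \<Longrightarrow> (a + b, b) \<in> P \<or> (b + a, a) \<in> P"
    and cancel: "a \<in> C \<Longrightarrow> b \<in> C \<Longrightarrow> c \<in> C \<Longrightarrow> (a, 0) \<notin> P \<Longrightarrow> (a * b, a * c) \<in> P \<Longrightarrow> (b, c) \<in> P"
    and proper: "(1, 0) \<notin> P"
begin

definition le :: "'a \<Rightarrow> 'a \<Rightarrow> bool" where
  "le a b \<longleftrightarrow> (a + b, b) \<in> P"

abbreviation vanishes :: "'a \<Rightarrow> bool" where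
  "vanishes a \<equiv> (a, 0) \<in> P"

lemma mem: "(a, b) \<in> P \<Longrightarrow> a \<in> C \<and> b \<in> C"
  and congr_refl: "a \<in> C \<Longrightarrow> (a, a) \<in> P"
  and congr_sym: "(a, b) \<in> P \<Longrightarrow> (b, a) \<in> P"
  using equiv by (auto simp: equiv_def refl_on_def sym_def)

lemma congr_trans: "(a, b) \<in> P \<Longrightarrow> (b, c) \<in> P \<Longrightarrow> (a, c) \<in> P"
  using equiv unfolding equiv_def by (meson transD)

lemma add_mem: "a \<in> C \<Longrightarrow> b \<in> C \<Longrightarrow> a + b \<in> C"
  and mult_mem: "a \<in> C \<Longrightarrow> b \<in> C \<Longrightarrow> a * b \<in> C"
  using add[of a a b b] mult[of a a b b] congr_refl mem by blast+

lemma sum_mem: "(\<And>i. i \<in> I \<Longrightarrow> h i \<in> C) \<Longrightarrow> sum h I \<in> C"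
  by (induction I rule: infinite_finite_induct) (auto simp: zero_mem add_mem)

lemma power_mem: "a \<in> C \<Longrightarrow> a ^ n \<in> C"
  by (induction n) (auto simp: one_mem mult_mem)

lemma le_refl: "a \<in> C \<Longrightarrow> le a a"
  by (simp add: le_def idem congr_refl)

lemma le_total: "a \<in> C \<Longrightarrow> b \<in> C \<Longrightarrow> le a b \<or> le b a"
  using total by (simp add: le_def)

lemma zero_le: "a \<in> C \<Longrightarrow> le 0 a"
  by (simp add: le_def congr_refl)

lemma le_zero_iff: "le a 0 \<longleftrightarrow> vanishes a"
  by (simp add: le_def)

lemma le_trans:
  assumes "a \<in> C" "b \<in> C" "c \<in> C" "le a b" "le b c"
  shows "le a c"
proof -
  have "(a + (b + c), a + c) \<in> P" using assms by (intro add congr_refl) (auto simp: le_def)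
  moreover have "((a + b) + c, b + c) \<in> P" using assms by (intro add congr_refl) (auto simp: le_def)
  ultimately have "(a + c, b + c) \<in> P" using congr_sym congr_trans by (metis add.assoc)
  then show ?thesis using assms(5) congr_trans unfolding le_def by blast
qed

lemma congruent_iff_le: 
  assumes "a \<in> C" "b \<in> C" shows "(a, b) \<in> P \<longleftrightarrow> le a b \<and> le b a"
proof
  assume "(a, b) \<in> P"
  from add[OF this congr_refl[OF assms(2)]] add[OF congr_sym[OF this] congr_refl[OF assms(1)]]
  show "le a b \<and> le b a" by (simp add: le_def idem assms)
next
  assume "le a b \<and> le b a"
  then show "(a, b) \<in> P" using congr_sym congr_trans unfolding le_def by (metis add.commute)
qed

lemma le_add_left: "a \<in> C \<Longrightarrow> b \<in> C \<Longrightarrow> le a (a + b)"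
  unfolding le_def by (simp add: idem congr_refl add_mem flip: add.assoc)

lemma add_le_iff:
  assumes "a \<in> C" "b \<in> C" "c \<in> C" shows "le (a + b) c \<longleftrightarrow> le a c \<and> le b c"
proof
  assume "le (a + b) c"
  then show "le a c \<and> le b c"
    using assms le_add_left[of a b] le_add_left[of b a] le_trans add_mem by (metis add.commute)
next
  assume "le a c \<and> le b c"
  then have "(a + (b + c), a + c) \<in> P" "(a + c, c) \<in> P"
    using assms by (auto simp: le_def intro!: add congr_refl)
  then show "le (a + b) c" unfolding le_def using congr_trans by (metis add.assoc)
qed

lemma le_add_iff:
  assumes "a \<in> C" "b \<in> C" "c \<in> C" shows "le a (b + c) \<longleftrightarrow> le a b \<or> le a c"
proof
  assume *: "le a (b + c)"
  from le_total[OF assms(2,3)] show "le a b \<or> le a c"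
  proof
    assume "le b c"
    then have "le (b + c) c" using assms by (simp add: add_le_iff le_refl)
    then show ?thesis using * assms le_trans add_mem by blast
  next
    assume "le c b"
    then have "le (b + c) b" using assms by (simp add: add_le_iff le_refl)
    then show ?thesis using * assms le_trans add_mem by blast
  qed
next
  assume "le a b \<or> le a c"
  then show "le a (b + c)"
    using assms le_add_left[of b c] le_add_left[of c b] le_trans add_mem by (metis add.commute)
qed

lemma sum_le_iff:
  assumes "finite I" "\<And>i. i \<in> I \<Longrightarrow> h i \<in> C" "c \<in> C"
  shows "le (sum h I) c \<longleftrightarrow> (\<forall>i\<in>I. le (h i) c)"
  using assms by (induction I rule: finite_induct) (auto simp: zero_le add_le_iff sum_mem)

lemma le_sum_iff:
  assumes "finite I" "\<And>i. i \<in> I \<Longrightarrow> h i \<in> C" "a \<in> C"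
  shows "le a (sum h I) \<longleftrightarrow> vanishes a \<or> (\<exists>i\<in>I. le a (h i))"
  using assms by (induction I rule: finite_induct) (auto simp: le_zero_iff le_add_iff sum_mem)

lemma le_mult:
  assumes "a \<in> C" "b \<in> C" "c \<in> C" "le a b" shows "le (c * a) (c * b)"
  using mult[OF congr_refl[OF assms(3)], of "a + b" b] assms by (simp add: le_def distrib_left)

lemma le_mult_mono:
  assumes "a \<in> C" "b \<in> C" "c \<in> C" "d \<in> C" "le a b" "le c d"
  shows "le (a * c) (b * d)"
  using le_mult[of a b c] le_mult[of c d b] assms le_trans mult_mem by (metis mult.commute)

lemma le_power: "a \<in> C \<Longrightarrow> b \<in> C \<Longrightarrow> le a b \<Longrightarrow> le (a ^ n) (b ^ n)"
  by (induction n) (auto simp: le_refl one_mem power_mem intro!: le_mult_mono)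

lemma le_cancel:
  assumes "a \<in> C" "b \<in> C" "c \<in> C" "\<not> vanishes c" "le (c * a) (c * b)" shows "le a b"
  using cancel[of c "a + b" b] assms add_mem by (simp add: le_def distrib_left)

lemma vanishes_mult_iff:
  assumes "a \<in> C" "b \<in> C" shows "vanishes (a * b) \<longleftrightarrow> vanishes a \<or> vanishes b"
  using cancel[of a b 0] mult[of a 0 b b] mult[of a a b 0] congr_refl zero_mem assms by auto

lemma unit_not_vanishes:
  assumes "a \<in> C" "b \<in> C" "a * b = 1" shows "\<not> vanishes a"
  using proper vanishes_mult_iff[OF assms(1,2)] assms(3) by auto

text \<open>
  Strict comparisons survive multiplication because the quotient is cancellative; without this
  the strict inequalities could not be added up.
\<close>

lemma strict_mult_mono:
  assumes "a \<in> C" "b \<in> C" "c \<in> C" "d \<in> C" "le c d" "\<not> le b a" "\<not> vanishes d"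
  shows "\<not> le (b * d) (a * c)"
proof
  assume "le (b * d) (a * c)"
  moreover have "le (a * c) (a * d)" using assms by (intro le_mult)
  ultimately have "le (d * b) (d * a)"
    using assms le_trans mult_mem by (metis mult.commute)
  then show False using le_cancel assms by blast
qed

end

section \<open>Tropical scalars and polynomials\<close>

definition real_log :: "trop \<Rightarrow> real" where
  "real_log c = real_of_ereal (log_trop c)"

lemma log_trop_not_PInf [simp]: "log_trop c \<noteq> \<infinity>"
  using log_trop[of c] by (simp add: R_minf_def)

lemma log_trop_zero [simp]: "log_trop 0 = - \<infinity>"
  and log_trop_one [simp]: "log_trop 1 = 0"
  and log_trop_add: "log_trop (c + d) = max (log_trop c) (log_trop d)"
  and log_trop_mult: "log_trop (c * d) = log_trop c + log_trop d"
  by (transfer; simp)+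

lemma log_trop_eq_MInf_iff [simp]: "log_trop c = - \<infinity> \<longleftrightarrow> c = 0"
  by transfer simp

lemma log_trop_eq_real_log: "c \<noteq> 0 \<Longrightarrow> log_trop c = ereal (real_log c)"
  by (cases "log_trop c") (auto simp: real_log_def)

lemma trop_mult_eq_0_iff [simp]: "c * d = 0 \<longleftrightarrow> c = 0 \<or> d = (0 :: trop)"
  by transfer (auto simp: R_minf_def plus_ereal.simps)

lemma trop_add_eq_0_iff [simp]: "c + d = 0 \<longleftrightarrow> c = 0 \<and> d = (0 :: trop)"
  by transfer (auto simp: max_def)

lemma trop_add_idem [simp]: "c + c = (c :: trop)"
  by transfer simp

lemma trop_add_absorb_iff: "c + d = d \<longleftrightarrow> log_trop c \<le> log_trop d"
  by transfer (auto simp: max_def)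

lemma real_log_mult: "c \<noteq> 0 \<Longrightarrow> d \<noteq> 0 \<Longrightarrow> real_log (c * d) = real_log c + real_log d"
  using log_trop_mult[of c d] by (simp add: log_trop_eq_real_log)

lemma real_log_one: "real_log 1 = 0"
  by (simp add: real_log_def)

lemma real_log_power: "c \<noteq> 0 \<Longrightarrow> c ^ n \<noteq> 0 \<and> real_log (c ^ n) = real n * real_log c"
  by (induction n) (auto simp: real_log_mult real_log_one algebra_simps)

lemma poly_trop_add_idem: "f + f = (f :: 'm \<Rightarrow>\<^sub>0 trop)"
  by (rule poly_mapping_eqI) (simp add: lookup_add)

lemma keys_add_trop: "Poly_Mapping.keys (f + g) = Poly_Mapping.keys f \<union> Poly_Mapping.keys (g :: 'm \<Rightarrow>\<^sub>0 trop)"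
  by (auto simp: in_keys_iff lookup_add)

lemma poly_mapping_eq_sum_terms:
  fixes f :: "'m \<Rightarrow>\<^sub>0 'c::comm_monoid_add"
  shows "f = (\<Sum>u\<in>Poly_Mapping.keys f. Poly_Mapping.single u (Poly_Mapping.lookup f u))"
proof (rule poly_mapping_eqI)
  fix v
  have "(\<Sum>u\<in>Poly_Mapping.keys f. Poly_Mapping.lookup (Poly_Mapping.single u (Poly_Mapping.lookup f u)) v)
      = (\<Sum>u\<in>Poly_Mapping.keys f. if u = v then Poly_Mapping.lookup f u else 0)"
    by (intro sum.cong) (auto simp: lookup_single)
  then show "Poly_Mapping.lookup f v = Poly_Mapping.lookup
      (\<Sum>u\<in>Poly_Mapping.keys f. Poly_Mapping.single u (Poly_Mapping.lookup f u)) v"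
    by (simp add: lookup_sum in_keys_iff)
qed

text \<open>
  The alternative \<open>h i = - \<infinity>\<close> accounts for the case that \<open>J\<close> is empty.
\<close>

lemma SUP_le_SUP_iff:
  fixes h k :: "_ \<Rightarrow> ereal"
  assumes "finite J"
  shows "(SUP i\<in>I. h i) \<le> (SUP j\<in>J. k j) \<longleftrightarrow> (\<forall>i\<in>I. h i = - \<infinity> \<or> (\<exists>j\<in>J. h i \<le> k j))"
proof -
  have "e \<le> (SUP j\<in>J. k j) \<longleftrightarrow> e = - \<infinity> \<or> (\<exists>j\<in>J. e \<le> k j)" for e
    using assms by (induction J rule: finite_induct) (auto simp: bot_ereal_def sup_max le_max_iff_disj)
  then show ?thesis unfolding SUP_le_iff by blast
qed

lemma monoid_semiring_ops:
  "f \<oplus>\<^bsub>monoid_semiring S M\<^esub> g = f + g" "f \<otimes>\<^bsub>monoid_semiring S M\<^esub> g = f * g"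
  "\<zero>\<^bsub>monoid_semiring S M\<^esub> = 0"
  by (simp_all add: monoid_semiring_def)

lemma zero_one_in_monoid_semiring:
  assumes "sub_semifield S" and "0 \<in> M"
  shows "0 \<in> carrier (monoid_semiring S M)" "1 \<in> carrier (monoid_semiring S M)"
  using assms by (auto simp: monoid_semiring_def sub_semifield_def lookup_one when_def)

section \<open>Coordinates of the lattice\<close>

lemma fg_free_abelian_coordinates:
  assumes "fg_free_abelian TYPE('m::ab_group_add)"
  obtains B :: "'m::ab_group_add set" and coord :: "'m::ab_group_add \<Rightarrow> 'm \<Rightarrow> int"
  where "finite B" "\<And>u v. coord (u + v) = (\<lambda>b. coord u b + coord v b)"
    "\<And>u. (\<And>b. b \<in> B \<Longrightarrow> coord u b = 0) \<Longrightarrow> u = 0"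
proof -
  interpret module "zscale :: int \<Rightarrow> 'm \<Rightarrow> 'm" by (rule module_zscale)
  from assms obtain B :: "'m set" where B: "finite B" "independent B" "span B = UNIV"
    unfolding fg_free_abelian_def by blast
  show ?thesis
  proof
    show "finite B" by (rule B)
    show "representation B (u + v) = (\<lambda>b. representation B u b + representation B v b)" for u v
      using B by (intro representation_add) auto
    show "u = 0" if "\<And>b. b \<in> B \<Longrightarrow> representation B u b = 0" for u
      using sum_representation_eq[of B u B] B that by simp
  qed
qed

section \<open>Realising a prime congruence by points\<close>

locale monomial_order =
  prime_order "carrier (monoid_semiring S M)" P
  for S :: "trop set" and M :: "'m::ab_group_add set" and P +
  assumes subsemifield: "sub_semifield S"
    and M_zero: "0 \<in> M" and M_add: "u \<in> M \<Longrightarrow> v \<in> M \<Longrightarrow> u + v \<in> M"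
begin

lemma scalars: "0 \<in> S" "1 \<in> S" "c \<in> S \<Longrightarrow> d \<in> S \<Longrightarrow> c * d \<in> S"
  using subsemifield by (auto simp: sub_semifield_def)

abbreviation C :: "('m \<Rightarrow>\<^sub>0 trop) set" where "C \<equiv> carrier (monoid_semiring S M)"

abbreviation monomial :: "trop \<Rightarrow> 'm \<Rightarrow> ('m \<Rightarrow>\<^sub>0 trop)" where
  "monomial c u \<equiv> Poly_Mapping.single u c"

text \<open>
  The live exponents form a face of the monoid; the realising point is finite exactly there.
\<close>

abbreviation live :: "'m \<Rightarrow> bool" where
  "live u \<equiv> \<not> vanishes (monomial 1 u)"

lemma monomial_mem: "c \<in> S \<Longrightarrow> u \<in> M \<Longrightarrow> monomial c u \<in> C"
  by (auto simp: monoid_semiring_def lookup_single when_def scalars)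

lemma scalar_not_vanishes:
  assumes "c \<in> S" "c \<noteq> 0" shows "\<not> vanishes (monomial c 0)"
proof -
  obtain d where "d \<in> S" "c * d = 1" using subsemifield assms by (auto simp: sub_semifield_def)
  then show ?thesis
    using unit_not_vanishes[of "monomial c 0" "monomial d 0"] assms M_zero
    by (simp add: monomial_mem mult_single)
qed

lemma monomial_split: "monomial c u = monomial c 0 * monomial 1 u"
  by (simp add: mult_single)

lemma vanishes_monomial_iff:
  assumes "c \<in> S" "c \<noteq> 0" "u \<in> M" shows "vanishes (monomial c u) \<longleftrightarrow> \<not> live u"
  using vanishes_mult_iff[of "monomial c 0" "monomial 1 u"] scalar_not_vanishes[OF assms(1,2)] assms
  by (simp add: monomial_mem M_zero scalars flip: monomial_split)

lemma live_add_iff: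
  assumes "u \<in> M" "v \<in> M" shows "live (u + v) \<longleftrightarrow> live u \<and> live v"
  using vanishes_mult_iff[of "monomial 1 u" "monomial 1 v"] assms
  by (simp add: mult_single monomial_mem scalars)

lemma le_scalar_of_log_le:
  assumes "c \<in> S" "d \<in> S" "log_trop c \<le> log_trop d"
  shows "le (monomial c 0) (monomial d 0)"
proof -
  have "c + d = d" using assms by (simp add: trop_add_absorb_iff)
  then show ?thesis using assms by (simp add: le_def congr_refl monomial_mem M_zero flip: single_add)
qed

lemma monomial_power: "monomial c 0 ^ n = monomial (c ^ n) 0"
  by (induction n) (simp_all add: mult_single)

text \<open>
  The order that a prime congruence induces on the scalars is either the usual one
  (\<open>r = 1\<close>) or trivial (\<open>r = 0\<close>): if it once reverses a strict inequality then, the scalars being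
  archimedean, powers of that reversal outweigh every other inequality.
\<close>

lemma scalar_order_dichotomy:
  obtains r :: real where "0 \<le> r"
    "\<And>c d. \<lbrakk>c \<in> S; d \<in> S; c \<noteq> 0; d \<noteq> 0; le (monomial c 0) (monomial d 0)\<rbrakk>
        \<Longrightarrow> r * real_log c \<le> r * real_log d"
    "\<And>c d. \<lbrakk>c \<in> S; d \<in> S; c \<noteq> 0; d \<noteq> 0; \<not> le (monomial d 0) (monomial c 0)\<rbrakk>
        \<Longrightarrow> r * real_log c < r * real_log d"
proof (cases "\<forall>c\<in>S. \<forall>d\<in>S. c \<noteq> 0 \<longrightarrow> d \<noteq> 0 \<longrightarrow> le (monomial c 0) (monomial d 0) \<longrightarrow> real_log c \<le> real_log d")
  case True
  show ?thesis
  proof (rule that[of 1])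
    fix c d assume "c \<in> S" "d \<in> S" "c \<noteq> 0" "d \<noteq> 0" "\<not> le (monomial d 0) (monomial c 0)"
    then show "1 * real_log c < 1 * real_log d"
      using le_scalar_of_log_le[of d c] by (force simp: log_trop_eq_real_log)
  qed (use True in auto)
next
  case False
  then obtain a b where ab: "a \<in> S" "b \<in> S" "a \<noteq> 0" "b \<noteq> 0" "le (monomial a 0) (monomial b 0)"
    "real_log b < real_log a" by force
  have all: "le (monomial c 0) (monomial d 0)" if "c \<in> S" "d \<in> S" "c \<noteq> 0" "d \<noteq> 0" for c d
  proof -
    \<comment> \<open>\<open>c b\<^sup>n \<le> d a\<^sup>n\<close> in the tropical order, while \<open>a \<le> b\<close> modulo the congruence.\<close>
    obtain n where n: "real_log c - real_log d < real n * (real_log a - real_log b)"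
      using reals_Archimedean3[of "real_log a - real_log b"] ab by auto
    have pow: "e ^ n \<in> S" if "e \<in> S" for e
      using that scalars by (induction n) auto
    have "log_trop (c * b ^ n) \<le> log_trop (d * a ^ n)"
      using n that ab by (simp add: log_trop_eq_real_log real_log_mult real_log_power algebra_simps)
    then have "le (monomial (c * b ^ n) 0) (monomial (d * a ^ n) 0)"
      using that ab pow scalars by (intro le_scalar_of_log_le) auto
    moreover have "le (monomial d 0 * monomial a 0 ^ n) (monomial d 0 * monomial b 0 ^ n)"
      using that ab by (intro le_mult le_power power_mem) (auto simp: monomial_mem M_zero)
    then have "le (monomial (d * a ^ n) 0) (monomial (d * b ^ n) 0)"
      by (simp add: monomial_power mult_single)
    ultimately have "le (monomial (c * b ^ n) 0) (monomial (d * b ^ n) 0)"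
      by (rule le_trans[rotated 3]) (use that ab pow scalars in \<open>simp_all add: monomial_mem M_zero\<close>)
    then have le: "le (monomial (b ^ n) 0 * monomial c 0) (monomial (b ^ n) 0 * monomial d 0)"
      by (simp add: mult_single mult.commute)
    show ?thesis
    proof (rule le_cancel[OF _ _ _ _ le])
      show "\<not> vanishes (monomial (b ^ n) 0)"
        using ab pow real_log_power[of b n] by (intro scalar_not_vanishes) auto
    qed (use that ab pow in \<open>simp_all add: monomial_mem M_zero\<close>)
  qed
  then show ?thesis by (intro that[of 0]) auto
qed

text \<open>
  Every inequality derived from valid comparisons of monomials is itself a valid comparison of
  monomials. A refutation would compare two monomials with the same exponent, that is two
  scalars, in a way that contradicts the choice of \<open>r\<close>.
\<close>

lemma realise_terms:
  assumes free: "fg_free_abelian TYPE('m)"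
    and T: "finite T" "\<And>c u. (c, u) \<in> T \<Longrightarrow> c \<in> S \<and> c \<noteq> 0 \<and> u \<in> M \<and> live u"
  obtains r :: real and y :: "'m \<Rightarrow> real" where "0 \<le> r" "\<And>u v. y (u + v) = y u + y v"
    "\<And>c u d v. (c, u) \<in> T \<Longrightarrow> (d, v) \<in> T \<Longrightarrow>
       le (monomial c u) (monomial d v) \<longleftrightarrow> r * real_log c + y u \<le> r * real_log d + y v"
proof -
  obtain B :: "'m set" and coord :: "'m \<Rightarrow> 'm \<Rightarrow> int" where
    B: "finite B" and coord_add: "\<And>u v. coord (u + v) = (\<lambda>b. coord u b + coord v b)"
    and coord_inj: "\<And>u. (\<And>b. b \<in> B \<Longrightarrow> coord u b = 0) \<Longrightarrow> u = 0"
    using fg_free_abelian_coordinates[OF free] by blast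
  have coord_diff: "coord (u - v) = (\<lambda>b. coord u b - coord v b)" for u v
    using coord_add[of "u - v" v] by auto
  obtain r where r: "0 \<le> r"
    and r_le: "\<And>c d. \<lbrakk>c \<in> S; d \<in> S; c \<noteq> 0; d \<noteq> 0; le (monomial c 0) (monomial d 0)\<rbrakk>
        \<Longrightarrow> r * real_log c \<le> r * real_log d"
    and r_less: "\<And>c d. \<lbrakk>c \<in> S; d \<in> S; c \<noteq> 0; d \<noteq> 0; \<not> le (monomial d 0) (monomial c 0)\<rbrakk>
        \<Longrightarrow> r * real_log c < r * real_log d"
    using scalar_order_dichotomy by blast
  define admissible where "admissible = (\<lambda>(c, u). c \<in> S \<and> c \<noteq> 0 \<and> u \<in> M \<and> live u)"
  define ineq :: "trop \<times> 'm \<Rightarrow> trop \<times> 'm \<Rightarrow> bool \<Rightarrow> 'm affine_ineq" where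
    "ineq = (\<lambda>(c, u) (d, v) s. (r * (real_log d - real_log c), coord (v - u), s))"
  have snd_ineq [simp]: "snd (snd (ineq t t' s)) = s" for t t' s
    by (simp add: ineq_def split: prod.splits)
  define leq where "leq = (\<lambda>(c, u) (d, v). le (monomial c u) (monomial d v))"
  define K where "K = (\<lambda>(t, t'). ineq t t' (\<not> leq t' t)) ` {(t, t') \<in> T \<times> T. leq t t'}"
  have "finite K" unfolding K_def
    by (intro finite_imageI finite_subset[OF _ finite_cartesian_product[OF T(1) T(1)]]) auto
  have invariant: "\<exists>t t'. k = ineq t t' (snd (snd k)) \<and> admissible t \<and> admissible t' \<and> leq t t'
      \<and> (snd (snd k) \<longrightarrow> \<not> leq t' t)" if "k \<in> consequences K" for k
    using that
  proof induction
    case (base k)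
    then obtain t t' where "k = ineq t t' (\<not> leq t' t)" "t \<in> T" "t' \<in> T" "leq t t'"
      by (auto simp: K_def)
    then show ?case using T(2)
      by (intro exI[of "\<lambda>t. \<exists>t'. _ t t'" t], intro exI[of _ t'])
        (auto simp: ineq_def admissible_def split: prod.splits)
  next
    case (add \<gamma> a s \<delta> e s')
    then obtain c1 u1 d1 v1 c2 u2 d2 v2 where
      1: "(\<gamma>, a, s) = ineq (c1, u1) (d1, v1) s" "admissible (c1, u1)" "admissible (d1, v1)"
         "le (monomial c1 u1) (monomial d1 v1)" "s \<longrightarrow> \<not> le (monomial d1 v1) (monomial c1 u1)" and
      2: "(\<delta>, e, s') = ineq (c2, u2) (d2, v2) s'" "admissible (c2, u2)" "admissible (d2, v2)"
         "le (monomial c2 u2) (monomial d2 v2)" "s' \<longrightarrow> \<not> le (monomial d2 v2) (monomial c2 u2)"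
      by (auto simp: leq_def)
    have mem: "monomial c1 u1 \<in> C" "monomial d1 v1 \<in> C" "monomial c2 u2 \<in> C" "monomial d2 v2 \<in> C"
      and nv: "\<not> vanishes (monomial d1 v1)" "\<not> vanishes (monomial d2 v2)"
      using 1 2 by (auto simp: admissible_def monomial_mem vanishes_monomial_iff)
    have "le (monomial c1 u1 * monomial c2 u2) (monomial d1 v1 * monomial d2 v2)"
      using 1 2 mem by (intro le_mult_mono)
    moreover have "\<not> le (monomial d1 v1 * monomial d2 v2) (monomial c1 u1 * monomial c2 u2)"
      if "s \<or> s'"
      using that strict_mult_mono[OF mem(1,2,3,4) 2(4)] strict_mult_mono[OF mem(3,4,1,2) 1(4)] 1(5) 2(5) nv
      by (auto simp: mult.commute)
    moreover have "admissible (c1 * c2, u1 + u2)" "admissible (d1 * d2, v1 + v2)"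
      using 1 2 by (auto simp: admissible_def scalars M_add live_add_iff)
    moreover have "(\<gamma> + \<delta>, \<lambda>b. a b + e b, s \<or> s') = ineq (c1 * c2, u1 + u2) (d1 * d2, v1 + v2) (s \<or> s')"
      using 1 2 by (auto simp: ineq_def admissible_def real_log_mult coord_add coord_diff algebra_simps)
    ultimately show ?case
      by (intro exI[of "\<lambda>t. \<exists>t'. _ t t'" "(c1 * c2, u1 + u2)"], intro exI[of _ "(d1 * d2, v1 + v2)"])
        (simp add: leq_def mult_single)
  qed
  have "\<not> (\<gamma> < 0 \<or> s \<and> \<gamma> \<le> 0)" if k: "(\<gamma>, a, s) \<in> consequences K" and a: "\<forall>b\<in>B. a b = 0" for \<gamma> a s
  proof -
    from invariant[OF k] obtain c u d v where *: "\<gamma> = r * (real_log d - real_log c)" "a = coord (v - u)"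
      "c \<in> S" "c \<noteq> 0" "u \<in> M" "live u" "d \<in> S" "d \<noteq> 0"
      "le (monomial c u) (monomial d v)" "s \<longrightarrow> \<not> le (monomial d v) (monomial c u)"
      by (auto simp: leq_def ineq_def admissible_def)
    from a * coord_inj[of "v - u"] have [simp]: "v = u" by simp
    have u: "monomial 1 u \<in> C" and cd: "monomial c 0 \<in> C" "monomial d 0 \<in> C"
      using * by (auto simp: monomial_mem scalars M_zero)
    have eq: "monomial e u = monomial 1 u * monomial e 0" for e by (simp add: mult_single)
    have "le (monomial c 0) (monomial d 0)"
      using *(9) eq[of c] eq[of d] le_cancel[OF cd u *(6)] by simp
    then have "0 \<le> \<gamma>" using r_le[of c d] * by (simp add: right_diff_distrib)
    moreover have "\<not> le (monomial d 0) (monomial c 0)" if s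
      using *(10) that eq[of c] eq[of d] le_mult[OF cd(2,1) u] by auto
    then have "0 < \<gamma>" if s using r_less[of c d] * that by (simp add: right_diff_distrib)
    ultimately show ?thesis by auto
  qed
  with solvable_or_refutable[OF B \<open>finite K\<close>] obtain x where x: "\<forall>k\<in>K. holds_at B x k" by blast
  define y where "y = (\<lambda>u. \<Sum>b\<in>B. of_int (coord u b) * x b)"
  have y_add: "y (u + v) = y u + y v" for u v
    by (simp add: y_def coord_add distrib_right sum.distrib)
  have y_diff: "y (u - v) = y u - y v" for u v
    using y_add[of "u - v" v] by simp
  have holds: "holds_at B x (ineq (c, u) (d, v) s) \<longleftrightarrow>
      (if s then r * real_log c + y u < r * real_log d + y v else r * real_log c + y u \<le> r * real_log d + y v)"
    for c u d v s
  proof -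
    have "(\<Sum>b\<in>B. of_int (coord (v - u) b) * x b) = y v - y u"
      using y_diff[of v u] by (simp add: y_def)
    then show ?thesis by (auto simp: holds_at_def ineq_def right_diff_distrib)
  qed
  show ?thesis
  proof (rule that[of r y])
    fix c u d v assume t: "(c, u) \<in> T" "(d, v) \<in> T"
    have imp: "holds_at B x (ineq t t' (\<not> leq t' t))" if "t \<in> T" "t' \<in> T" "leq t t'" for t t'
    proof -
      have "ineq t t' (\<not> leq t' t) \<in> K"
        unfolding K_def by (rule image_eqI[of _ _ "(t, t')"]) (use that in auto)
      then show ?thesis using x by blast
    qed
    show "le (monomial c u) (monomial d v) \<longleftrightarrow> r * real_log c + y u \<le> r * real_log d + y v"
    proof (cases "le (monomial c u) (monomial d v)")
      case True
      with imp[OF t] show ?thesis by (auto simp: leq_def holds split: if_splits)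
    next
      case False
      then have "le (monomial d v) (monomial c u)"
        using le_total T(2) t monomial_mem by blast
      with False imp[OF t(2,1)] show ?thesis by (auto simp: leq_def holds split: if_splits)
    qed
  qed (use r y_add in auto)
qed

end

context monomial_order
begin

lemma C_iff: "f \<in> C \<longleftrightarrow> Poly_Mapping.keys f \<subseteq> M \<and> (\<forall>u. Poly_Mapping.lookup f u \<in> S)"
  by (simp add: monoid_semiring_def)

text \<open>
  A polynomial is the sum of its terms, and a sum is the maximum of its summands. The right-hand
  side has the same shape as the comparison of two tropical values in \<open>SUP_le_SUP_iff\<close>.
\<close>

lemma le_iff_terms:
  assumes "f \<in> C" "g \<in> C"
  shows "le f g \<longleftrightarrow> (\<forall>u\<in>Poly_Mapping.keys f. vanishes (monomial (Poly_Mapping.lookup f u) u) \<or>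
    (\<exists>v\<in>Poly_Mapping.keys g. le (monomial (Poly_Mapping.lookup f u) u) (monomial (Poly_Mapping.lookup g v) v)))"
proof -
  let ?t = "\<lambda>f u. monomial (Poly_Mapping.lookup f u) u"
  have mem: "?t h u \<in> C" if "h \<in> C" "u \<in> Poly_Mapping.keys h" for h u
    using that by (intro monomial_mem) (auto simp: C_iff)
  have "le f g \<longleftrightarrow> le (sum (?t f) (Poly_Mapping.keys f)) g"
    by (simp flip: poly_mapping_eq_sum_terms)
  also have "\<dots> \<longleftrightarrow> (\<forall>u\<in>Poly_Mapping.keys f. le (?t f u) g)"
    using assms mem by (intro sum_le_iff) auto
  also have "\<dots> \<longleftrightarrow> (\<forall>u\<in>Poly_Mapping.keys f. le (?t f u) (sum (?t g) (Poly_Mapping.keys g)))"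
    by (simp flip: poly_mapping_eq_sum_terms)
  also have "\<dots> \<longleftrightarrow> (\<forall>u\<in>Poly_Mapping.keys f. vanishes (?t f u) \<or> (\<exists>v\<in>Poly_Mapping.keys g. le (?t f u) (?t g v)))"
    using assms mem by (intro ball_cong refl le_sum_iff) auto
  finally show ?thesis .
qed

text \<open>
  The solution found for the live terms is extended by \<open>-\<infinity>\<close> to the other exponents. This is a
  monoid homomorphism because a product of monomials vanishes modulo \<open>P\<close> only if a factor does.
\<close>

theorem realise_polynomials:
  assumes free: "fg_free_abelian TYPE('m)" and M: "M = toric_monoid \<sigma>"
    and H: "finite H" "H \<subseteq> C"
  obtains w where "w \<in> {0..} \<times> N_sigma \<sigma>"
    "\<And>f g. \<lbrakk>f \<in> H; g \<in> H\<rbrakk> \<Longrightarrow> (f, g) \<in> P \<longleftrightarrow> trop_eval f w = trop_eval g w"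
proof -
  define T where "T = {(c, u) \<in> (\<Union>f\<in>H. (\<lambda>u. (Poly_Mapping.lookup f u, u)) ` Poly_Mapping.keys f). live u}"
  have "T \<subseteq> (\<Union>f\<in>H. (\<lambda>u. (Poly_Mapping.lookup f u, u)) ` Poly_Mapping.keys f)"
    by (auto simp: T_def)
  then have "finite T" by (rule finite_subset) (simp add: H(1))
  have T: "c \<in> S \<and> c \<noteq> 0 \<and> u \<in> M \<and> live u" if "(c, u) \<in> T" for c u
    using that H(2) by (auto simp: T_def C_iff subset_iff in_keys_iff)
  have T_mem: "(Poly_Mapping.lookup f u, u) \<in> T"
    if "f \<in> H" "u \<in> Poly_Mapping.keys f" "live u" for f u
    using that by (auto simp: T_def)
  obtain r :: real and y :: "'m \<Rightarrow> real" where r: "0 \<le> r" and y: "\<And>u v. y (u + v) = y u + y v"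
    and ry: "\<And>c u d v. (c, u) \<in> T \<Longrightarrow> (d, v) \<in> T \<Longrightarrow>
       le (monomial c u) (monomial d v) \<longleftrightarrow> r * real_log c + y u \<le> r * real_log d + y v"
    using realise_terms[OF free \<open>finite T\<close> T] by blast
  define x where "x = (\<lambda>u. if u \<in> M then if live u then ereal (y u) else - \<infinity> else undefined)"
  have "y 0 = 0" using y[of 0 0] by simp
  moreover have "live 0" using scalar_not_vanishes[of 1] scalars by simp
  ultimately have x: "x \<in> N_sigma \<sigma>"
    using M_zero M_add y live_add_iff
    by (auto simp: N_sigma_def x_def R_minf_def M[symmetric] split: if_splits)
  let ?v = "\<lambda>c u. ereal r * log_trop c + x u"
  have v_live: "?v c u = ereal (r * real_log c + y u)" if "c \<noteq> 0" "u \<in> M" "live u" for c u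
    using that by (simp add: x_def log_trop_eq_real_log)
  have v_dead: "?v c u = - \<infinity>" if "c \<noteq> 0" "u \<in> M" "\<not> live u" for c u
    using that by (simp add: x_def log_trop_eq_real_log)
  have le_iff: "le f g \<longleftrightarrow> trop_eval f (r, x) \<le> trop_eval g (r, x)" if "f \<in> H" "g \<in> H" for f g
  proof -
    have fg: "f \<in> C" "g \<in> C" using that H by auto
    have coeff: "Poly_Mapping.lookup h u \<in> S" "Poly_Mapping.lookup h u \<noteq> 0" "u \<in> M"
      if "h \<in> C" "u \<in> Poly_Mapping.keys h" for h u
      using that by (auto simp: C_iff in_keys_iff)
    have van: "vanishes (monomial (Poly_Mapping.lookup f u) u) \<longleftrightarrow> ?v (Poly_Mapping.lookup f u) u = - \<infinity>"
      if "u \<in> Poly_Mapping.keys f" for u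
      using coeff[OF fg(1) that] v_live v_dead by (cases "live u") (simp_all add: vanishes_monomial_iff)
    have cmp: "le (monomial (Poly_Mapping.lookup f u) u) (monomial (Poly_Mapping.lookup g v) v) \<longleftrightarrow>
        ?v (Poly_Mapping.lookup f u) u \<le> ?v (Poly_Mapping.lookup g v) v"
      if "u \<in> Poly_Mapping.keys f" "v \<in> Poly_Mapping.keys g" "live u" for u v
    proof (cases "live v")
      case True
      then show ?thesis
        using ry[OF T_mem T_mem] that \<open>f \<in> H\<close> \<open>g \<in> H\<close> coeff[OF fg(1) that(1)] coeff[OF fg(2) that(2)]
        by (simp add: v_live)
    next
      case False
      let ?s = "monomial (Poly_Mapping.lookup f u) u" and ?t = "monomial (Poly_Mapping.lookup g v) v"
      note cf = coeff[OF fg(1) that(1)] and cg = coeff[OF fg(2) that(2)]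
      have "\<not> le ?s ?t"
      proof
        assume "le ?s ?t"
        moreover have "le ?t 0" using False cg by (simp add: le_zero_iff vanishes_monomial_iff)
        ultimately have "le ?s 0" using le_trans cf cg monomial_mem zero_mem by metis
        then show False using cf that by (simp add: le_zero_iff vanishes_monomial_iff)
      qed
      then show ?thesis unfolding v_live[OF cf(2,3) that(3)] v_dead[OF cg(2,3) False] by simp
    qed
    show ?thesis
      unfolding le_iff_terms[OF fg] trop_eval_def prod.case SUP_le_SUP_iff[OF finite_keys]
    proof (intro ball_cong refl)
      fix u assume u: "u \<in> Poly_Mapping.keys f"
      show "vanishes (monomial (Poly_Mapping.lookup f u) u) \<or>
          (\<exists>v\<in>Poly_Mapping.keys g. le (monomial (Poly_Mapping.lookup f u) u) (monomial (Poly_Mapping.lookup g v) v)) \<longleftrightarrow>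
        ?v (Poly_Mapping.lookup f u) u = - \<infinity> \<or>
          (\<exists>v\<in>Poly_Mapping.keys g. ?v (Poly_Mapping.lookup f u) u \<le> ?v (Poly_Mapping.lookup g v) v)"
      proof (cases "live u")
        case True
        then show ?thesis using cmp[OF u] van[OF u] by blast
      next
        case False
        then show ?thesis using van[OF u] v_dead coeff[OF fg(1) u] by blast
      qed
    qed
  qed
  show ?thesis
  proof (rule that[of "(r, x)"])
    fix f g assume fg: "f \<in> H" "g \<in> H"
    then have "(f, g) \<in> P \<longleftrightarrow> le f g \<and> le g f" using congruent_iff_le H by blast
    then show "(f, g) \<in> P \<longleftrightarrow> trop_eval f (r, x) = trop_eval g (r, x)"
      using le_iff fg by auto
  qed (use r x in auto)
qed

end

lemma monomial_order_of_prime: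
  assumes "sub_semifield S" and "0 \<in> M" "\<And>u v. u \<in> M \<Longrightarrow> v \<in> M \<Longrightarrow> u + v \<in> M"
    and prime: "prime_congruence (monoid_semiring S M) P"
  shows "monomial_order S M P"
proof -
  let ?A = "monoid_semiring S M"
  note simps = monoid_semiring_ops[of S]
  note C = zero_one_in_monoid_semiring[OF assms(1,2)]
  from prime have congr: "semiring_congruence ?A P"
    and proper: "P \<noteq> carrier ?A \<times> carrier ?A"
    and tot: "totally_ordered_semiring (quotient_semiring ?A P)"
    and can: "cancellative_semiring (quotient_semiring ?A P)"
    by (auto simp: prime_congruence_def)
  note eq = congruence_equiv[OF congr]
  have mult: "(a * c, b * d) \<in> P" if "(a, b) \<in> P" "(c, d) \<in> P" for a b c d
    using congruence_mult[OF congr that] by (simp add: simps)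
  have add: "(a + c, b + d) \<in> P" if "(a, b) \<in> P" "(c, d) \<in> P" for a b c d
    using congruence_add[OF congr that] by (simp add: simps)
  have proper': "(1, 0) \<notin> P"
  proof
    assume "(1, 0) \<in> P"
    then have zero: "(a, 0) \<in> P" if "a \<in> carrier ?A" for a
      using mult[of a a 1 0] congruence_refl[OF congr that] by simp
    have "(a, b) \<in> P" if "a \<in> carrier ?A" "b \<in> carrier ?A" for a b
      using zero[OF that(1)] zero[OF that(2)] eq unfolding equiv_def by (meson symD transD)
    with proper show False using congruence_mem[OF congr] by auto
  qed
  have total: "(a + b, b) \<in> P \<or> (b + a, a) \<in> P" if "a \<in> carrier ?A" "b \<in> carrier ?A" for a b
    using tot that unfolding totally_ordered_quotient_iff[OF congr] simps by blast
  have cancel: "(b, c) \<in> P" if "a \<in> carrier ?A" "b \<in> carrier ?A" "c \<in> carrier ?A"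
      "(a, 0) \<notin> P" "(a * b, a * c) \<in> P" for a b c
    using can that C(1) unfolding cancellative_quotient_iff[OF congr, unfolded simps, OF C(1)] by blast
  show ?thesis
    by (intro monomial_order.intro prime_order.intro monomial_order_axioms.intro)
      (fact eq add mult C total cancel proper' assms(1-3) | rule poly_trop_add_idem)+
qed

section \<open>Evaluation at a point\<close>

text \<open>
  For \<open>r \<ge> 0\<close>, the endomorphism \<open>c \<mapsto> c\<^sup>r\<close> of the tropical semifield. It sends \<open>0\<close> to \<open>0\<close> even for
  \<open>r = 0\<close>, although \<open>0 * (-\<infinity>) = 0\<close> in the extended reals.
\<close>

definition scalar_power :: "real \<Rightarrow> trop \<Rightarrow> trop" where
  "scalar_power r c = (if c = 0 then 0 else Trop (ereal (r * real_log c)))"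

text \<open>
  The evaluation of polynomials with values in the tropical semifield itself, which makes
  multiplicativity a computation with sums and products.
\<close>

definition point_eval :: "real \<Rightarrow> ('m \<Rightarrow> ereal) \<Rightarrow> ('m \<Rightarrow>\<^sub>0 trop) \<Rightarrow> trop" where
  "point_eval r x f = (\<Sum>u\<in>Poly_Mapping.keys f. scalar_power r (Poly_Mapping.lookup f u) * Trop (x u))"

lemma log_trop_Trop: "e \<noteq> \<infinity> \<Longrightarrow> log_trop (Trop e) = e"
  by (simp add: Trop_inverse R_minf_def)

lemma log_scalar_power: "log_trop (scalar_power r c) = (if c = 0 then - \<infinity> else ereal (r * real_log c))"
  by (simp add: scalar_power_def log_trop_Trop)

lemma scalar_power_0 [simp]: "scalar_power r 0 = 0"
  by (simp add: scalar_power_def)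

lemma scalar_power_mult: "scalar_power r (c * d) = scalar_power r c * scalar_power r d"
  by (subst log_trop_inject[symmetric])
    (auto simp: log_scalar_power log_trop_mult real_log_mult distrib_left)

lemma scalar_power_add:
  assumes "0 \<le> r" shows "scalar_power r (c + d) = scalar_power r c + scalar_power r d"
proof -
  have absorb: "scalar_power r (a + b) = scalar_power r a + scalar_power r b"
    if "log_trop a \<le> log_trop b" for a b
  proof -
    have "log_trop (scalar_power r a) \<le> log_trop (scalar_power r b)"
      using that assms log_trop_eq_real_log[of a] log_trop_eq_real_log[of b]
      by (auto simp: log_scalar_power mult_left_mono)
    then have "scalar_power r a + scalar_power r b = scalar_power r b"
      by (simp add: trop_add_absorb_iff)
    moreover from that have "a + b = b" by (simp add: trop_add_absorb_iff)
    ultimately show ?thesis by simp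
  qed
  from absorb[of c d] absorb[of d c] show ?thesis by (metis add.commute linear)
qed

lemma log_trop_sum: "finite I \<Longrightarrow> log_trop (sum h I) = (SUP i\<in>I. log_trop (h i))"
  by (induction I rule: finite_induct) (auto simp: log_trop_add sup_max bot_ereal_def)

lemma trop_mult_cancel: "a \<noteq> 0 \<Longrightarrow> a * b = a * c \<Longrightarrow> b = (c :: trop)"
  by transfer (auto simp: R_minf_def ereal_add_cancel_left)

context
  fixes \<sigma> :: "('m::ab_group_add \<Rightarrow> real) set" and r :: real and x :: "'m \<Rightarrow> ereal"
  assumes r: "0 \<le> r" and x: "x \<in> N_sigma \<sigma>"
begin

lemma N_sigma_not_PInf: "u \<in> toric_monoid \<sigma> \<Longrightarrow> x u \<noteq> \<infinity>"
  using x by (auto simp: N_sigma_def R_minf_def Pi_iff PiE_iff)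

lemma trop_eval_eq_log_point_eval:
  assumes "Poly_Mapping.keys f \<subseteq> toric_monoid \<sigma>"
  shows "trop_eval f (r, x) = log_trop (point_eval r x f)"
  unfolding trop_eval_def point_eval_def prod.case log_trop_sum[OF finite_keys]
proof (intro SUP_cong refl)
  fix u assume "u \<in> Poly_Mapping.keys f"
  then show "ereal r * log_trop (Poly_Mapping.lookup f u) + x u =
      log_trop (scalar_power r (Poly_Mapping.lookup f u) * Trop (x u))"
    using assms N_sigma_not_PInf[of u]
    by (auto simp: log_trop_mult log_scalar_power log_trop_Trop log_trop_eq_real_log in_keys_iff subset_iff)
qed

lemma point_eval_superset:
  assumes "finite U" "Poly_Mapping.keys f \<subseteq> U"
  shows "point_eval r x f = (\<Sum>u\<in>U. scalar_power r (Poly_Mapping.lookup f u) * Trop (x u))"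
  unfolding point_eval_def using assms by (intro sum.mono_neutral_left) (auto simp: in_keys_iff)

lemma point_eval_0 [simp]: "point_eval r x 0 = 0"
  by (simp add: point_eval_def)

lemma point_eval_add: "point_eval r x (f + g) = point_eval r x f + point_eval r x g"
proof -
  let ?U = "Poly_Mapping.keys f \<union> Poly_Mapping.keys g"
  have "finite ?U" by simp
  then show ?thesis
    by (simp add: point_eval_superset[of ?U] keys_add_trop lookup_add scalar_power_add r
        distrib_right sum.distrib)
qed

lemma point_eval_sum: "point_eval r x (sum h I) = (\<Sum>i\<in>I. point_eval r x (h i))"
  by (induction I rule: infinite_finite_induct) (auto simp: point_eval_add)

lemma point_eval_single: "point_eval r x (Poly_Mapping.single u c) = scalar_power r c * Trop (x u)"
  by (simp add: point_eval_superset[of "{u}"])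

lemma point_eval_1: "point_eval r x 1 = 1"
proof -
  have "x 0 = 0" using x by (simp add: N_sigma_def)
  then show ?thesis
    unfolding single_one[symmetric] point_eval_single
    by (simp add: log_trop_inject[symmetric] log_trop_mult log_scalar_power log_trop_Trop real_log_one)
qed

lemma point_eval_mult:
  assumes "Poly_Mapping.keys f \<subseteq> toric_monoid \<sigma>" "Poly_Mapping.keys g \<subseteq> toric_monoid \<sigma>"
  shows "point_eval r x (f * g) = point_eval r x f * point_eval r x g"
proof -
  have Trop_add: "Trop (x (u + v)) = Trop (x u) * Trop (x v)"
    if "u \<in> toric_monoid \<sigma>" "v \<in> toric_monoid \<sigma>" for u v
  proof -
    have "x (u + v) = x u + x v" using that x by (simp add: N_sigma_def)
    then show ?thesis
      using that[THEN N_sigma_not_PInf]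
      by (simp add: log_trop_inject[symmetric] log_trop_mult log_trop_Trop)
  qed
  have "f * g = (\<Sum>u\<in>Poly_Mapping.keys f. \<Sum>v\<in>Poly_Mapping.keys g.
      Poly_Mapping.single (u + v) (Poly_Mapping.lookup f u * Poly_Mapping.lookup g v))"
    by (subst poly_mapping_eq_sum_terms[of f], subst poly_mapping_eq_sum_terms[of g])
      (simp add: sum_product mult_single)
  then have "point_eval r x (f * g) = (\<Sum>u\<in>Poly_Mapping.keys f. \<Sum>v\<in>Poly_Mapping.keys g.
      scalar_power r (Poly_Mapping.lookup f u * Poly_Mapping.lookup g v) * Trop (x (u + v)))"
    by (simp add: point_eval_sum point_eval_single)
  also have "\<dots> = (\<Sum>u\<in>Poly_Mapping.keys f. \<Sum>v\<in>Poly_Mapping.keys g.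
      (scalar_power r (Poly_Mapping.lookup f u) * Trop (x u)) *
      (scalar_power r (Poly_Mapping.lookup g v) * Trop (x v)))"
    using assms by (intro sum.cong refl) (auto simp: Trop_add scalar_power_mult mult_ac subset_iff)
  finally show ?thesis by (simp add: point_eval_def sum_product)
qed

text \<open>
  The quotient embeds into the tropical semifield, which is totally ordered and cancellative.
\<close>

lemma prime_congruence_at_point:
  fixes S :: "trop set"
  defines "A \<equiv> monoid_semiring S (toric_monoid \<sigma>)"
  assumes S: "sub_semifield S" and "0 \<in> toric_monoid \<sigma>"
    and closed: "\<And>a b. a \<in> carrier A \<Longrightarrow> b \<in> carrier A \<Longrightarrow> a + b \<in> carrier A"
      "\<And>a b. a \<in> carrier A \<Longrightarrow> b \<in> carrier A \<Longrightarrow> a * b \<in> carrier A"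
  shows "prime_congruence A {(f, g). f \<in> carrier A \<and> g \<in> carrier A \<and> trop_eval f (r, x) = trop_eval g (r, x)}"
proof -
  define Q where "Q = {(f, g). f \<in> carrier A \<and> g \<in> carrier A \<and> trop_eval f (r, x) = trop_eval g (r, x)}"
  note simps = monoid_semiring_ops[of S "toric_monoid \<sigma>", folded A_def]
  have keys: "Poly_Mapping.keys f \<subseteq> toric_monoid \<sigma>" if "f \<in> carrier A" for f
    using that by (simp add: A_def monoid_semiring_def)
  note C = zero_one_in_monoid_semiring[OF assms(2,3), folded A_def]
  have Q: "(f, g) \<in> Q \<longleftrightarrow> f \<in> carrier A \<and> g \<in> carrier A \<and> point_eval r x f = point_eval r x g" for f g
    using keys by (auto simp: Q_def trop_eval_eq_log_point_eval log_trop_inject)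
  have congr: "semiring_congruence A Q"
    unfolding semiring_congruence_def
  proof (intro conjI)
    show "equiv (carrier A) Q"
      by (auto simp: equiv_def refl_on_def sym_def trans_def Q)
  qed (auto simp: Q simps closed point_eval_add point_eval_mult keys)
  moreover have "(1, 0) \<notin> Q" by (simp add: Q point_eval_1)
  then have "Q \<noteq> carrier A \<times> carrier A" using C by blast
  moreover have "totally_ordered_semiring (quotient_semiring A Q)"
    unfolding totally_ordered_quotient_iff[OF congr]
    by (auto simp: Q simps closed point_eval_add trop_add_absorb_iff)
  moreover have "cancellative_semiring (quotient_semiring A Q)"
    unfolding cancellative_quotient_iff[OF congr, unfolded simps, OF C(1)]
    by (auto simp: Q C closed point_eval_mult keys dest: trop_mult_cancel)
  ultimately show ?thesis by (simp add: prime_congruence_def Q_def)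
qed

end

section \<open>Continuity of the evaluation\<close>

lemma exp_minf_MInf [simp]: "exp_minf (- \<infinity>) = 0"
  and exp_minf_ereal [simp]: "exp_minf (ereal a) = exp a"
  by (simp_all add: exp_minf_def)

lemma exp_minf_add: "a \<noteq> \<infinity> \<Longrightarrow> exp_minf (ereal b + a) = exp b * exp_minf a"
  by (cases a) (simp_all add: exp_add)

lemma exp_minf_max: "a \<noteq> \<infinity> \<Longrightarrow> b \<noteq> \<infinity> \<Longrightarrow> exp_minf (max a b) = max (exp_minf a) (exp_minf b)"
  by (cases a; cases b) (auto simp: max_def)

lemma exp_minf_inject: "a \<noteq> \<infinity> \<Longrightarrow> b \<noteq> \<infinity> \<Longrightarrow> exp_minf a = exp_minf b \<longleftrightarrow> a = b"
  by (cases a; cases b) auto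

lemma SUP_not_PInf:
  fixes h :: "'a \<Rightarrow> ereal"
  assumes "finite U" "\<And>u. u \<in> U \<Longrightarrow> h u \<noteq> \<infinity>"
  shows "(SUP u\<in>U. h u) \<noteq> \<infinity>"
  using assms by (induction U rule: finite_induct) (auto simp: bot_ereal_def sup_max max_def)

lemma topspace_tropical_space: "topspace (tropical_space_topology \<sigma>) = {0..} \<times> N_sigma \<sigma>"
proof -
  have "topspace R_minf_topology = R_minf"
    by (auto simp: R_minf_topology_def topspace_pullback_topology exp_minf_def)
  then have "topspace (N_sigma_topology \<sigma>) = N_sigma \<sigma>"
    by (auto simp: N_sigma_topology_def N_sigma_def)
  then show ?thesis by (simp add: tropical_space_topology_def)
qed

lemma continuous_map_coordinate:
  assumes "u \<in> toric_monoid \<sigma>"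
  shows "continuous_map (tropical_space_topology \<sigma>) euclideanreal (\<lambda>w. exp_minf (snd w u))"
proof -
  have "continuous_map (tropical_space_topology \<sigma>) (N_sigma_topology \<sigma>) snd"
    by (simp add: tropical_space_topology_def continuous_map_snd)
  moreover have "continuous_map (N_sigma_topology \<sigma>) R_minf_topology (\<lambda>x. x u)"
    unfolding N_sigma_topology_def
    by (intro continuous_map_from_subtopology continuous_map_product_projection assms)
  moreover have "continuous_map R_minf_topology (top_of_set {0..}) exp_minf"
    using continuous_map_pullback[OF continuous_map_id] by (simp add: R_minf_topology_def)
  ultimately have "continuous_map (tropical_space_topology \<sigma>) (top_of_set {0..}) (exp_minf \<circ> ((\<lambda>x. x u) \<circ> snd))"
    by (intro continuous_map_compose)
  then show ?thesis
    by (auto simp: o_def intro: continuous_map_into_fulltopology)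
qed

lemma continuous_map_radius:
  "continuous_map (tropical_space_topology \<sigma>) euclideanreal fst"
proof -
  have "continuous_map (tropical_space_topology \<sigma>) (top_of_set {0..}) fst"
    by (simp add: tropical_space_topology_def continuous_map_fst)
  then show ?thesis by (rule continuous_map_into_fulltopology)
qed

lemma continuous_map_exp_minf_SUP:
  assumes "finite U" "\<And>u. u \<in> U \<Longrightarrow> continuous_map X euclideanreal (\<lambda>w. exp_minf (h u w))"
    "\<And>u w. u \<in> U \<Longrightarrow> w \<in> topspace X \<Longrightarrow> h u w \<noteq> \<infinity>"
  shows "continuous_map X euclideanreal (\<lambda>w. exp_minf (SUP u\<in>U. h u w))"
  using assms
proof (induction U rule: finite_induct)
  case empty
  then show ?case by simp
next
  case (insert u U)
  have "continuous_map X euclideanreal (\<lambda>w. max (exp_minf (h u w)) (exp_minf (SUP u\<in>U. h u w)))"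
    using insert by (intro continuous_map_real_max) auto
  moreover have "max (exp_minf (h u w)) (exp_minf (SUP u\<in>U. h u w)) = exp_minf (SUP u\<in>insert u U. h u w)"
    if "w \<in> topspace X" for w
    using insert that SUP_not_PInf[of U "\<lambda>u. h u w"] by (simp add: exp_minf_max sup_max)
  ultimately show ?case by (rule continuous_map_eq)
qed

lemma trop_eval_not_PInf:
  assumes "Poly_Mapping.keys f \<subseteq> toric_monoid \<sigma>" "w \<in> {0..} \<times> N_sigma \<sigma>"
  shows "trop_eval f w \<noteq> \<infinity>"
  using assms by (cases w) (simp add: trop_eval_eq_log_point_eval[of _ _ \<sigma>])

lemma continuous_map_trop_eval:
  assumes "Poly_Mapping.keys f \<subseteq> toric_monoid \<sigma>"
  shows "continuous_map (tropical_space_topology \<sigma>) euclideanreal (\<lambda>w. exp_minf (trop_eval f w))"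
proof -
  let ?X = "tropical_space_topology \<sigma>"
  let ?h = "\<lambda>u w. ereal (fst w) * log_trop (Poly_Mapping.lookup f u) + snd w u"
  have fin: "snd w u \<noteq> \<infinity>" if "u \<in> Poly_Mapping.keys f" "w \<in> topspace ?X" for u and w :: "real \<times> ('a \<Rightarrow> ereal)"
    using that assms N_sigma_not_PInf[of "fst w" "snd w" \<sigma> u]
    by (auto simp: topspace_tropical_space)
  have h: "?h u w = ereal (fst w * real_log (Poly_Mapping.lookup f u)) + snd w u"
    if "u \<in> Poly_Mapping.keys f" for u w
    using that by (simp add: log_trop_eq_real_log in_keys_iff)
  have "continuous_map ?X euclideanreal (\<lambda>w. exp_minf (SUP u\<in>Poly_Mapping.keys f. ?h u w))"
  proof (rule continuous_map_exp_minf_SUP)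
    fix u assume u: "u \<in> Poly_Mapping.keys f"
    have "continuous_map ?X euclideanreal (exp \<circ> (\<lambda>w. fst w * real_log (Poly_Mapping.lookup f u)))"
      by (intro continuous_map_compose[where X' = euclideanreal] continuous_map_real_mult continuous_map_radius)
        (auto intro: continuous_intros)
    then have "continuous_map ?X euclideanreal
        (\<lambda>w. exp (fst w * real_log (Poly_Mapping.lookup f u)) * exp_minf (snd w u))"
      using u assms by (intro continuous_map_real_mult continuous_map_coordinate) (auto simp: o_def)
    moreover have "exp (fst w * real_log (Poly_Mapping.lookup f u)) * exp_minf (snd w u) = exp_minf (?h u w)"
      if "w \<in> topspace ?X" for w
      unfolding h[OF u] by (rule exp_minf_add[OF fin[OF u that], symmetric])
    ultimately show "continuous_map ?X euclideanreal (\<lambda>w. exp_minf (?h u w))"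
      by (rule continuous_map_eq)
  next
    fix u w assume "u \<in> Poly_Mapping.keys f" "w \<in> topspace ?X"
    then show "?h u w \<noteq> \<infinity>" unfolding h[OF \<open>u \<in> _\<close>] using fin by simp
  qed simp
  then show ?thesis by (simp add: trop_eval_def case_prod_unfold)
qed

text \<open>
  After the exponential, the two values are continuous real functions of the point. No loss
  occurs, since the exponential is injective on values other than \<open>\<infinity>\<close>.
\<close>

lemma trop_eval_eq_on_closure:
  assumes "w \<in> tropical_space_topology \<sigma> closure_of W"
    and f: "Poly_Mapping.keys f \<subseteq> toric_monoid \<sigma>" and g: "Poly_Mapping.keys g \<subseteq> toric_monoid \<sigma>"
    and eq: "\<And>w. w \<in> W \<Longrightarrow> trop_eval f w = trop_eval g w"
  shows "trop_eval f w = trop_eval g w"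
proof -
  have "exp_minf (trop_eval f w) = exp_minf (trop_eval g w)"
    by (rule forall_in_closure_of_eq[OF assms(1) _ continuous_map_trop_eval[OF f] continuous_map_trop_eval[OF g]])
      (simp_all add: eq)
  moreover have "w \<in> {0..} \<times> N_sigma \<sigma>"
    using assms(1) closure_of_subset_topspace[of "tropical_space_topology \<sigma>" W]
    by (auto simp: topspace_tropical_space)
  ultimately show ?thesis
    using exp_minf_inject trop_eval_not_PInf f g by blast
qed

section \<open>Cancellativity of the quotient by the radical\<close>

lemma trop_eval_finite_point:
  assumes "w \<in> {0..} \<times> N_finite \<sigma>" "Poly_Mapping.keys f \<subseteq> toric_monoid \<sigma>" "f \<noteq> 0"
  shows "trop_eval f w \<noteq> - \<infinity>"
proof -
  obtain u where u: "u \<in> Poly_Mapping.keys f" using assms(3) keys_eq_empty[of f] by blast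
  have "ereal (fst w) * log_trop (Poly_Mapping.lookup f u) + snd w u \<noteq> - \<infinity>"
    using assms u by (auto simp: N_finite_def log_trop_eq_real_log in_keys_iff)
  moreover have "ereal (fst w) * log_trop (Poly_Mapping.lookup f u) + snd w u \<le> trop_eval f w"
    unfolding trop_eval_def case_prod_unfold by (rule SUP_upper[OF u])
  ultimately show ?thesis by auto
qed

lemma toric_monoid_submonoid:
  assumes "rational_polyhedral_cone \<sigma>"
  shows "0 \<in> toric_monoid \<sigma>"
    and "\<And>u v. u \<in> toric_monoid \<sigma> \<Longrightarrow> v \<in> toric_monoid \<sigma> \<Longrightarrow> u + v \<in> toric_monoid \<sigma>"
proof -
  have "Modules.additive v" if "v \<in> \<sigma>" for v
  proof -
    from that assms obtain G c where G: "G \<subseteq> N_lattice" "v = (\<lambda>u. \<Sum>g\<in>G. c g * g u)"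
      unfolding rational_polyhedral_cone_def by blast
    then have g: "g (x + y) = g x + g y" if "g \<in> G" for g x y
      using that by (auto simp: N_lattice_def N_real_def Modules.additive_def)
    have "(\<Sum>g\<in>G. c g * g (x + y)) = (\<Sum>g\<in>G. c g * g x + c g * g y)" for x y
      by (intro sum.cong refl) (simp add: g distrib_left)
    then show ?thesis
      unfolding Modules.additive_def G(2) by (simp add: sum.distrib)
  qed
  then have zero: "v 0 = 0" and add: "v (x + y) = v x + v y" if "v \<in> \<sigma>" for v x y
    using that additive.zero additive.add by blast+
  show "0 \<in> toric_monoid \<sigma>"
    unfolding toric_monoid_def using eq_refl[OF zero] by blast
  show "u + v \<in> toric_monoid \<sigma>" if "u \<in> toric_monoid \<sigma>" "v \<in> toric_monoid \<sigma>" for u v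
    unfolding toric_monoid_def
  proof (intro CollectI ballI)
    fix y assume "y \<in> \<sigma>"
    then show "y (u + v) \<le> 0"
      unfolding add[OF \<open>y \<in> \<sigma>\<close>] using that by (intro add_nonpos_nonpos) (auto simp: toric_monoid_def)
  qed
qed

theorem theorem1p4:
  fixes S :: "trop set"
    and \<sigma> :: "('m::ab_group_add \<Rightarrow> real) set"
    and E :: "(('m \<Rightarrow>\<^sub>0 trop) \<times> ('m \<Rightarrow>\<^sub>0 trop)) set"
  assumes "sub_semifield S"
    and "fg_free_abelian TYPE('m)"
    and "rational_polyhedral_cone \<sigma>"
    and "strongly_convex_cone \<sigma>"
    and "semiring_congruence (monoid_semiring S (toric_monoid \<sigma>)) E"
    and "finite_tropical_basis \<sigma> E"
    and "trop_variety \<sigma> E =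
           tropical_space_topology \<sigma> closure_of (trop_variety \<sigma> E \<inter> ({0..} \<times> N_finite \<sigma>))"
  shows "cancellative_semiring
           (quotient_semiring (monoid_semiring S (toric_monoid \<sigma>))
              (congruence_radical (monoid_semiring S (toric_monoid \<sigma>)) E))"
proof -
  let ?M = "toric_monoid \<sigma>" and ?A = "monoid_semiring S (toric_monoid \<sigma>)"
  let ?R = "congruence_radical ?A E"
  let ?W = "trop_variety \<sigma> E \<inter> ({0..} \<times> N_finite \<sigma>)"
  note M = toric_monoid_submonoid[OF assms(3)]
  note simps = monoid_semiring_ops[of S]
  note zero = zero_one_in_monoid_semiring(1)[OF assms(1) M(1)]
  have closed: "a + b \<in> carrier ?A" "a * b \<in> carrier ?A" if "a \<in> carrier ?A" "b \<in> carrier ?A" for a b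
    using congruence_closed[OF assms(5) that] by (simp_all add: simps)
  have keys: "Poly_Mapping.keys f \<subseteq> ?M" if "f \<in> carrier ?A" for f
    using that by (simp add: monoid_semiring_def)
  have E_carrier: "f \<in> carrier ?A \<and> g \<in> carrier ?A" if "(f, g) \<in> E" for f g
    using that congruence_mem[OF assms(5)] by blast
  have R_congr: "semiring_congruence ?A ?R"
    by (rule semiring_congruence_radical) (simp_all add: simps closed)
  have in_prime: "(b, c) \<in> P"
    if a: "a \<in> carrier ?A" "(a, 0) \<notin> ?R" and bc: "b \<in> carrier ?A" "c \<in> carrier ?A"
      and abac: "(a * b, a * c) \<in> ?R" and P: "prime_congruence ?A P" "E \<subseteq> P" for a b c P
  proof -
    have "a \<noteq> 0" using a(2) congruence_refl[OF R_congr zero] by auto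
    \<comment> \<open>At a finite point of the variety, \<open>a\<close> has a finite value and can be cancelled.\<close>
    have finite_points: "trop_eval b w = trop_eval c w" if "w \<in> ?W" for w
    proof -
      have w: "0 \<le> fst w" "snd w \<in> N_sigma \<sigma>" "w \<in> {0..} \<times> N_finite \<sigma>"
        using that by (auto simp: N_finite_def)
      let ?Q = "{(f, g). f \<in> carrier ?A \<and> g \<in> carrier ?A \<and> trop_eval f (fst w, snd w) = trop_eval g (fst w, snd w)}"
      have Q: "prime_congruence ?A ?Q"
        by (rule prime_congruence_at_point[OF w(1,2) assms(1) M(1) closed])
      have "E \<subseteq> ?Q" using that E_carrier by (auto simp: trop_variety_def)
      with Q abac have "(a * b, a * c) \<in> ?Q" by (auto simp: congruence_radical_def)
      moreover have "(a, 0) \<notin> ?Q"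
        using trop_eval_finite_point[OF w(3) keys[OF a(1)] \<open>a \<noteq> 0\<close>]
        by (auto simp: trop_eval_def bot_ereal_def)
      moreover have "semiring_congruence ?A ?Q" "cancellative_semiring (quotient_semiring ?A ?Q)"
        using Q by (auto simp: prime_congruence_def)
      ultimately have "(b, c) \<in> ?Q"
        using cancellative_quotient_iff[of ?A ?Q, unfolded simps, OF _ zero] a(1) bc by blast
      then show ?thesis by simp
    qed
    have variety: "trop_eval b w = trop_eval c w" if "w \<in> trop_variety \<sigma> E" for w
      using that trop_eval_eq_on_closure[OF _ keys[OF bc(1)] keys[OF bc(2)] finite_points]
      by (subst (asm) assms(7)) blast
    interpret monomial_order S ?M P
      by (rule monomial_order_of_prime[OF assms(1) M P(1)])
    obtain F where F: "finite F" "F \<subseteq> E" "trop_variety \<sigma> E = trop_variety \<sigma> F"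
      using assms(6) unfolding finite_tropical_basis_def by blast
    \<comment> \<open>The given prime is replaced by a point of the variety that cannot be told apart from it
      by the basis and by \<open>b\<close> and \<open>c\<close>.\<close>
    define H where "H = fst ` F \<union> snd ` F \<union> {b, c}"
    have "finite H" using F(1) by (simp add: H_def)
    moreover have "H \<subseteq> carrier ?A"
    proof -
      have "fst p \<in> carrier ?A \<and> snd p \<in> carrier ?A" if "p \<in> F" for p
        using that F(2) E_carrier[of "fst p" "snd p"] by auto
      then show ?thesis using bc by (auto simp: H_def)
    qed
    ultimately obtain w where w: "w \<in> {0..} \<times> N_sigma \<sigma>"
      and realise: "\<And>f g. \<lbrakk>f \<in> H; g \<in> H\<rbrakk> \<Longrightarrow> (f, g) \<in> P \<longleftrightarrow> trop_eval f w = trop_eval g w"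
      using realise_polynomials[OF assms(2) refl] by blast
    have "trop_eval f w = trop_eval g w" if "(f, g) \<in> F" for f g
    proof -
      have "f \<in> H" "g \<in> H" using that by (force simp: H_def)+
      then show ?thesis using realise that F(2) P(2) by blast
    qed
    then have "w \<in> trop_variety \<sigma> E" using w unfolding F(3) by (auto simp: trop_variety_def)
    then have "trop_eval b w = trop_eval c w" by (rule variety)
    then show ?thesis using realise[of b c] by (simp add: H_def)
  qed
  show ?thesis
    unfolding cancellative_quotient_iff[OF R_congr, unfolded simps, OF zero]
  proof (intro ballI impI)
    fix a b c
    assume abc: "a \<in> carrier ?A" "(a, 0) \<notin> ?R" "b \<in> carrier ?A" "c \<in> carrier ?A"
      "(a * b, a * c) \<in> ?R"
    have "(b, c) \<in> P" if "prime_congruence ?A P" "E \<subseteq> P" for P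
      by (rule in_prime[OF abc that])
    with abc(3,4) show "(b, c) \<in> ?R"
      unfolding congruence_radical_def by blast
  qed
qed

end
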